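(* Let $1 \le p < \infty$. There is a constant $c_p > 0$, depending only on $p$, such that the following holds. Let $\varphi \colon \mathbb{D} \to \mathbb{D}$ be analytic and let $C_\varphi \colon H^p \to H^p$ be the composition operator with symbol $\varphi$. Let $n \ge 1$ and let $u_1, \ldots, u_n \in \mathbb{D}$ be such that $v_1 = \varphi(u_1), \ldots, v_n = \varphi(u_n)$ are distinct. Then $$ a_n(C_\varphi) \ \ge\ c_p \, \kappa_v^{-1} \Big(1 + \log \frac{1}{\delta_u}\Big)^{-1/\min(p,2)} \inf_{1 \le j \le n} \bigg( \frac{1 - |u_j|^2}{1 - |v_j|^2} \bigg)^{1/p}, $$ where $\delta_u$ is the uniform separation constant of the finite sequence $u = (u_1, \ldots, u_n)$ and $\kappa_v$ is the interpolation constant of the finite sequence $v = (v_1, \ldots, v_n)$.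
   Context: $\mathbb{D}$ is the open unit disk and $H^p$ is the classical Hardy space on $\mathbb{D}$, with norm $\|\cdot\|_p$. For an analytic map $\varphi \colon \mathbb{D} \to \mathbb{D}$, $C_\varphi f = f \circ \varphi$. For a bounded operator $T \colon X \to Y$ between Banach spaces, the $n$-th approximation number ($n \ge 1$) is $a_n(T) = \inf\{\|T - R\| : R \colon X \to Y,\ \mathrm{rank}\, R < n\}$. For a finite sequence $\sigma = (z_1, \ldots, z_n)$ of distinct points of $\mathbb{D}$, the uniform separation constant is $$\delta_\sigma = \inf_{1 \le j \le n} \prod_{k \ne j} \Big| \frac{z_j - z_k}{1 - \overline{z_j} z_k} \Big|$$ (an empty product being equal to $1$), and the interpolation constant is $$\kappa_\sigma = \sup_{|a_1|, \ldots, |a_n| \le 1} \inf\{ \|f\|_\infty : f \in H^\infty,\ f(z_j) = a_j,\ 1 \le j \le n \}.$$ *)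

theory Defs
  imports "HOL-Complex_Analysis.Complex_Analysis" "HOL-Library.Function_Algebras"
begin

(* Complex-valued functions form a complex vector space under the pointwise operations.  The Banach
   spaces below are linear subspaces of such a space, given by a carrier set and a norm. *)
global_interpretation cfun: vector_space "\<lambda>(c::complex) (f::'a \<Rightarrow> complex) x. c * f x"
  by unfold_locales (auto simp: fun_eq_iff algebra_simps)

(* The norm of an unbounded operator is infinity, whence the type ennreal. *)
definition operator_norm ::
    "('a \<Rightarrow> complex) set \<Rightarrow> (('a \<Rightarrow> complex) \<Rightarrow> ennreal) \<Rightarrow> (('b \<Rightarrow> complex) \<Rightarrow> ennreal)
      \<Rightarrow> (('a \<Rightarrow> complex) \<Rightarrow> ('b \<Rightarrow> complex)) \<Rightarrow> ennreal" where
  "operator_norm X NX NY T = (SUP f\<in>{f \<in> X. NX f \<le> 1}. NY (T f))"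

definition linear_between ::
    "('a \<Rightarrow> complex) set \<Rightarrow> ('b \<Rightarrow> complex) set \<Rightarrow> (('a \<Rightarrow> complex) \<Rightarrow> ('b \<Rightarrow> complex)) \<Rightarrow> bool" where
  "linear_between X Y T \<longleftrightarrow>
     (\<forall>f\<in>X. T f \<in> Y) \<and>
     (\<forall>f\<in>X. \<forall>g\<in>X. T (f + g) = T f + T g) \<and>
     (\<forall>c. \<forall>f\<in>X. T (\<lambda>x. c * f x) = (\<lambda>y. c * T f y))"

(* Finiteness of the basis is required because card is 0 on infinite sets. *)
definition rank_less ::
    "('a \<Rightarrow> complex) set \<Rightarrow> (('a \<Rightarrow> complex) \<Rightarrow> ('b \<Rightarrow> complex)) \<Rightarrow> nat \<Rightarrow> bool" where
  "rank_less X R n \<longleftrightarrow>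
     (\<exists>B. finite B \<and> cfun.independent B \<and> cfun.span B = R ` X \<and> card B < n)"

definition approximation_number ::
    "('a \<Rightarrow> complex) set \<Rightarrow> (('a \<Rightarrow> complex) \<Rightarrow> ennreal)
      \<Rightarrow> ('b \<Rightarrow> complex) set \<Rightarrow> (('b \<Rightarrow> complex) \<Rightarrow> ennreal)
      \<Rightarrow> nat \<Rightarrow> (('a \<Rightarrow> complex) \<Rightarrow> ('b \<Rightarrow> complex)) \<Rightarrow> ennreal" where
  "approximation_number X NX Y NY n T =
     (INF R\<in>{R. linear_between X Y R \<and> operator_norm X NX NY R < \<infinity> \<and> rank_less X R n}.
        operator_norm X NX NY (\<lambda>f. T f - R f))"

abbreviation unit_disk :: "complex set" where
  "unit_disk \<equiv> ball 0 1"

(* A function on the disk is represented by its extension by 0 to the whole plane, so that equality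
   of elements is equality of functions on the disk and the norms are definite. *)
definition disk_holomorphic :: "(complex \<Rightarrow> complex) set" where
  "disk_holomorphic = {f. f holomorphic_on unit_disk \<and> (\<forall>z. z \<notin> unit_disk \<longrightarrow> f z = 0)}"

definition integral_mean :: "real \<Rightarrow> (complex \<Rightarrow> complex) \<Rightarrow> real \<Rightarrow> real" where
  "integral_mean p f r =
     (1 / (2 * pi) * integral {0..2 * pi} (\<lambda>t. norm (f (of_real r * cis t)) powr p)) powr (1 / p)"

definition hardy_norm :: "real \<Rightarrow> (complex \<Rightarrow> complex) \<Rightarrow> ennreal" where
  "hardy_norm p f = (SUP r\<in>{0..<1}. ennreal (integral_mean p f r))"

definition hardy_space :: "real \<Rightarrow> (complex \<Rightarrow> complex) set" where
  "hardy_space p = {f \<in> disk_holomorphic. hardy_norm p f < \<infinity>}"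

definition hardy_inf_space :: "(complex \<Rightarrow> complex) set" where
  "hardy_inf_space = {f \<in> disk_holomorphic. bounded (f ` unit_disk)}"

definition hardy_inf_norm :: "(complex \<Rightarrow> complex) \<Rightarrow> real" where
  "hardy_inf_norm f = (SUP z\<in>unit_disk. norm (f z))"

definition composition_operator ::
    "(complex \<Rightarrow> complex) \<Rightarrow> (complex \<Rightarrow> complex) \<Rightarrow> (complex \<Rightarrow> complex)" where
  "composition_operator \<phi> f = (\<lambda>z. if z \<in> unit_disk then f (\<phi> z) else 0)"

definition hardy_approximation_number ::
    "real \<Rightarrow> nat \<Rightarrow> ((complex \<Rightarrow> complex) \<Rightarrow> (complex \<Rightarrow> complex)) \<Rightarrow> ennreal" where
  "hardy_approximation_number p n T =
     approximation_number (hardy_space p) (hardy_norm p) (hardy_space p) (hardy_norm p) n T"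

(* Finite sequences z_1, ..., z_n are functions on nat of which only the values on {1..n} matter. *)

definition uniform_separation_constant :: "nat \<Rightarrow> (nat \<Rightarrow> complex) \<Rightarrow> real" where
  "uniform_separation_constant n z =
     (INF j\<in>{1..n}. \<Prod>k\<in>{1..n} - {j}. norm ((z j - z k) / (1 - cnj (z j) * z k)))"

definition interpolation_constant :: "nat \<Rightarrow> (nat \<Rightarrow> complex) \<Rightarrow> real" where
  "interpolation_constant n z =
     (SUP a\<in>{a :: nat \<Rightarrow> complex. \<forall>j\<in>{1..n}. norm (a j) \<le> 1}.
        INF f\<in>{f \<in> hardy_inf_space. \<forall>j\<in>{1..n}. f (z j) = a j}. hardy_inf_norm f)"

end

(* The evaluations f |-> (1 - |u_j|^2)^(1/p) f(u_j) map H^p into l^p with norm at most a constant times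
   (1 + log (1/delta_u))^(1/p): this is the Carleson embedding for the measure with masses 1 - |u_j|^2 at
   the points u_j.  If R has rank less than n, some nonzero combination of them, with coefficients w_j,
   annihilates the range of R, so that on C_phi f - R f it takes the value sum_j w_j f(v_j).  Hence it
   suffices to make this sum large for some f in the unit ball of H^p.  Take f = F Psi / (2 kappa_v),
   where the outer function Psi satisfies |Psi|^p = sum_j a_j^p P_{v_j} on the circle (P_v is the
   Poisson kernel), so that |Psi(v_j)| >= a_j (1 - |v_j|^2)^(-1/p) for all j at once, and F in H^infinity
   rotates the values w_j Psi(v_j) to nonnegative numbers.  The exponent 1/p obtained in
   this way is at most 1/min(p,2). *)
theory Submission
  imports Defs
begin

section \<open>Means over the circle and the Poisson formula\<close>

text \<open>The boundary is the obstacle: \<open>hardy_norm\<close> is a supremum of means over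
  circles of radius below 1, so a function in H^p brings no values on the unit circle with it. Such
  functions are therefore used only through their dilations f(r w), r < 1, and every integrand on
  the unit circle is continuous. The logarithm has an elementary source. If rho_k is the
  pseudohyperbolic distance from u_i to u_k, the sums of normalized kernels that test the embedding
  have the terms 1 - rho_k^2 <= - 2 ln rho_k, and the rho_k multiply up to a product that is at
  least delta_u. That such sums control the embedding is proved in L^2: |g|^(p/2) is subharmonic,
  and duality with a sum of Poisson kernels leaves a quadratic form that can be absorbed. The test
  function has to be large at all v_j at once. A plain sum of kernels could suffer cancellation; an
  outer function has a prescribed modulus instead. Concavity of the logarithm, as Jensen's
  inequality, keeps its means below those of the harmonic function with boundary values sum_j a_j^p
  P_{v_j}, whose value at 0 is sum_j a_j^p.\<close>

definition circle_mean :: "(complex \<Rightarrow> 'a::euclidean_space) \<Rightarrow> 'a" where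
  "circle_mean f = (1 / (2 * pi)) *\<^sub>R integral {0..2 * pi} (\<lambda>t. f (cis t))"

lemma continuous_on_cis_circle:
  assumes "continuous_on (sphere 0 1) f"
  shows "continuous_on S (\<lambda>t. f (cis t))"
  by (rule continuous_on_compose2[OF assms]) (auto intro: continuous_intros)

lemma integrable_circle:
  fixes f :: "complex \<Rightarrow> 'a::euclidean_space"
  assumes "continuous_on (sphere 0 1) f"
  shows "(\<lambda>t. f (cis t)) integrable_on {0..2 * pi}"
  by (intro integrable_continuous_real continuous_on_cis_circle assms)

lemma circle_mean_cong:
  assumes "\<And>w. norm w = 1 \<Longrightarrow> f w = g w"
  shows "circle_mean f = circle_mean g"
  unfolding circle_mean_def using assms by simp

lemma circle_mean_const [simp]: "circle_mean (\<lambda>_. c) = c"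
  by (simp add: circle_mean_def)

lemma circle_mean_add:
  fixes f :: "complex \<Rightarrow> 'a::euclidean_space"
  assumes "continuous_on (sphere 0 1) f" "continuous_on (sphere 0 1) g"
  shows "circle_mean (\<lambda>w. f w + g w) = circle_mean f + circle_mean g"
  unfolding circle_mean_def using assms
  by (simp add: integral_add integrable_circle scaleR_add_right)

lemma circle_mean_mult_left:
  fixes f :: "complex \<Rightarrow> real"
  shows "circle_mean (\<lambda>w. c * f w) = c * circle_mean f"
  unfolding circle_mean_def by simp

lemma circle_mean_sum:
  fixes f :: "'b \<Rightarrow> complex \<Rightarrow> 'a::euclidean_space"
  assumes "finite J" "\<And>j. j \<in> J \<Longrightarrow> continuous_on (sphere 0 1) (f j)"
  shows "circle_mean (\<lambda>w. \<Sum>j\<in>J. f j w) = (\<Sum>j\<in>J. circle_mean (f j))"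
  unfolding circle_mean_def using assms
  by (subst integral_sum) (auto simp: integrable_circle scaleR_sum_right)

lemma circle_mean_mono:
  fixes f g :: "complex \<Rightarrow> real"
  assumes "continuous_on (sphere 0 1) f" "continuous_on (sphere 0 1) g"
    and "\<And>w. norm w = 1 \<Longrightarrow> f w \<le> g w"
  shows "circle_mean f \<le> circle_mean g"
proof -
  have "integral {0..2 * pi} (\<lambda>t. f (cis t)) \<le> integral {0..2 * pi} (\<lambda>t. g (cis t))"
    using assms by (intro integral_le integrable_circle) auto
  then show ?thesis
    unfolding circle_mean_def by (simp add: divide_right_mono)
qed

lemma circle_mean_nonneg:
  fixes f :: "complex \<Rightarrow> real"
  assumes "continuous_on (sphere 0 1) f" "\<And>w. norm w = 1 \<Longrightarrow> f w \<ge> 0"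
  shows "circle_mean f \<ge> 0"
  using circle_mean_mono[of "\<lambda>_. 0" f] assms by simp

lemma norm_circle_mean_le:
  fixes f :: "complex \<Rightarrow> 'a::euclidean_space"
  assumes "continuous_on (sphere 0 1) f"
  shows "norm (circle_mean f) \<le> circle_mean (\<lambda>w. norm (f w))"
proof -
  have "norm (integral {0..2 * pi} (\<lambda>t. f (cis t))) \<le> integral {0..2 * pi} (\<lambda>t. norm (f (cis t)))"
    by (intro integral_norm_bound_integral integrable_circle continuous_intros assms) auto
  then show ?thesis
    unfolding circle_mean_def by (simp add: divide_right_mono)
qed

lemma Re_circle_mean:
  fixes f :: "complex \<Rightarrow> complex"
  assumes "continuous_on (sphere 0 1) f"
  shows "Re (circle_mean f) = circle_mean (\<lambda>w. Re (f w))"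
proof -
  have "integral {0..2 * pi} (\<lambda>t. Re (f (cis t))) = Re (integral {0..2 * pi} (\<lambda>t. f (cis t)))"
    using integral_linear[OF integrable_circle[OF assms] bounded_linear_Re] by (simp add: o_def)
  then show ?thesis
    unfolding circle_mean_def by simp
qed

lemma tendsto_circle_mean:
  fixes f :: "'b \<Rightarrow> complex \<Rightarrow> real"
  assumes lim: "uniform_limit (sphere 0 1) f g F"
    and cont: "\<forall>\<^sub>F n in F. continuous_on (sphere 0 1) (f n)" and "F \<noteq> bot"
  shows "((\<lambda>n. circle_mean (f n)) \<longlongrightarrow> circle_mean g) F"
proof (rule tendstoI)
  fix e :: real assume "e > 0"
  then have "\<forall>\<^sub>F n in F. \<forall>w\<in>sphere 0 1. dist (f n w) (g w) < e / 2"
    using uniform_limitD[OF lim, of "e / 2"] by auto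
  with cont show "\<forall>\<^sub>F n in F. dist (circle_mean (f n)) (circle_mean g) < e"
  proof eventually_elim
    case (elim n)
    have cg: "continuous_on (sphere 0 1) g"
      using uniform_limit_theorem[OF cont lim] \<open>F \<noteq> bot\<close> by simp
    have less: "\<bar>f n w - g w\<bar> < e / 2" if "norm w = 1" for w
      using elim(2) that by (auto simp: dist_real_def)
    have less1: "f n w \<le> g w + e / 2" and less2: "g w \<le> f n w + e / 2" if "norm w = 1" for w
      using less[OF that] by linarith+
    have "circle_mean (f n) \<le> circle_mean (\<lambda>w. g w + e / 2)"
      using elim cg by (intro circle_mean_mono continuous_intros) (use less1 less2 in auto)
    moreover have "circle_mean g \<le> circle_mean (\<lambda>w. f n w + e / 2)"
      using elim cg by (intro circle_mean_mono continuous_intros) (use less1 less2 in auto)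
    ultimately show ?case
      using cg elim(1) \<open>e > 0\<close> by (simp add: circle_mean_add dist_real_def)
  qed
qed

section \<open>The Poisson kernel and its reproducing property\<close>

definition poisson :: "complex \<Rightarrow> complex \<Rightarrow> real" where
  "poisson z w = (1 - (norm z)\<^sup>2) / (norm (w - z))\<^sup>2"

lemma poisson_nonneg: "norm z < 1 \<Longrightarrow> poisson z w \<ge> 0"
  unfolding poisson_def by (simp add: power_le_one)

lemma poisson_pos: "norm z < 1 \<Longrightarrow> norm w = 1 \<Longrightarrow> poisson z w > 0"
  unfolding poisson_def by (intro divide_pos_pos) (auto simp: abs_square_less_1)

lemma continuous_on_poisson:
  assumes "norm z < 1"
  shows "continuous_on (sphere 0 1) (poisson z)"
  unfolding poisson_def using assms by (intro continuous_intros) auto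

lemma norm_diff_circle:
  assumes "norm w = 1"
  shows "norm (w - z) = norm (1 - cnj z * w)"
proof -
  have "w * cnj w = 1" using assms complex_norm_square[of w] by simp
  then have "w * cnj (w - z) = 1 - cnj z * w" by (simp add: algebra_simps)
  then have "norm (1 - cnj z * w) = norm w * norm (cnj (w - z))" by (metis norm_mult)
  then show ?thesis using assms by (simp only: complex_mod_cnj mult_1)
qed

lemma one_minus_mult_neq_0:
  fixes a b :: complex
  assumes "norm a < 1" "norm b \<le> 1"
  shows "1 - a * b \<noteq> 0"
proof
  assume "1 - a * b = 0"
  then have "norm (a * b) = 1" by simp
  moreover have "norm (a * b) < 1"
    using assms mult_left_mono[of "norm b" 1 "norm a"] by (simp add: norm_mult)
  ultimately show False by simp
qed

text \<open>For a = cnj z * w with |w| = 1 the right side is the Poisson kernel; this exhibits the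
  kernel as the real part of a function holomorphic in w, and equally in z.\<close>

lemma Re_cayley:
  fixes a :: complex
  assumes "1 - a \<noteq> 0"
  shows "Re ((1 + a) / (1 - a)) = (1 - (norm a)\<^sup>2) / (norm (1 - a))\<^sup>2"
proof -
  have "Re ((1 + a) / (1 - a)) = ((1 + Re a) * (1 - Re a) - Im a * Im a) / (norm (1 - a))\<^sup>2"
    unfolding Re_divide cmod_power2 by (simp add: algebra_simps power2_eq_square diff_divide_distrib add_divide_distrib)
  also have "(1 + Re a) * (1 - Re a) - Im a * Im a = 1 - (norm a)\<^sup>2"
    unfolding cmod_power2 by (simp add: power2_eq_square algebra_simps)
  finally show ?thesis .
qed

lemma poisson_eq_Re:
  assumes "norm z < 1" "norm w = 1"
  shows "poisson z w = Re ((1 + cnj z * w) / (1 - cnj z * w))"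
proof -
  have "1 - cnj z * w \<noteq> 0" using one_minus_mult_neq_0[of "cnj z" w] assms by simp
  from Re_cayley[OF this] show ?thesis
    using assms norm_diff_circle[of w z] by (simp add: poisson_def norm_mult)
qed

(* Cauchy's formula for F(w) (1 - |z|^2) / (1 - cnj z w) at w = z. *)
lemma poisson_integral_holomorphic:
  fixes F :: "complex \<Rightarrow> complex"
  assumes F: "F holomorphic_on cball 0 1" and z: "norm z < 1"
  shows "circle_mean (\<lambda>w. complex_of_real (poisson z w) * F w) = F z"
proof -
  define G where "G = (\<lambda>w. F w * (1 - cnj z * z) / (1 - cnj z * w))"
  have nz: "1 - cnj z * w \<noteq> 0" if "norm w \<le> 1" for w
    using one_minus_mult_neq_0[of "cnj z" w] z that by simp
  have "G holomorphic_on cball 0 1"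
    unfolding G_def by (intro holomorphic_intros F) (use nz in auto)
  from Cauchy_integral_circlepath_simple[OF this, of z] z
  have "((\<lambda>w. G w / (w - z)) has_contour_integral 2 * of_real pi * \<i> * G z) (circlepath 0 1)"
    by simp
  then have I: "((\<lambda>t. G (cis t) / (cis t - z) * \<i> * cis t) has_integral 2 * of_real pi * \<i> * G z) {0..2*pi}"
    unfolding circlepath_def by (subst (asm) has_contour_integral_part_circlepath_iff) auto
  \<comment> \<open>On the circle dw = i w dt and 1 - cnj z w = w cnj(w - z), so the factor 1 / (1 -
    cnj z w) in \<open>G\<close> completes the Cauchy kernel to the Poisson kernel.\<close>
  have eq: "G (cis t) / (cis t - z) * \<i> * cis t = \<i> * (poisson z (cis t) * F (cis t))" for t
  proof -
    define w where "w = cis t"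
    have w: "norm w = 1" "w * cnj w = 1" using complex_norm_square[of w] by (auto simp: w_def)
    have "w - z \<noteq> 0" using w z by auto
    have "1 - cnj z * w = w * cnj (w - z)"
      using w by (simp add: algebra_simps)
    moreover have "complex_of_real ((norm (w - z))\<^sup>2) = (w - z) * cnj (w - z)"
      by (rule complex_norm_square)
    moreover have "complex_of_real ((norm z)\<^sup>2) = z * cnj z"
      by (rule complex_norm_square)
    ultimately have "G w / (w - z) * w = F w * (1 - cnj z * z) / (w * cnj (w - z)) / (w - z) * w"
        and "complex_of_real (poisson z w) = (1 - cnj z * z) / ((w - z) * cnj (w - z))"
      unfolding G_def poisson_def by (simp_all add: mult_ac)
    moreover have "w \<noteq> 0" using w by auto
    ultimately have "G w / (w - z) * w = poisson z w * F w"
      by (simp add: mult_ac)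
    then have "\<i> * (G w / (w - z) * w) = \<i> * (poisson z w * F w)" by simp
    moreover have "G w / (w - z) * \<i> * w = \<i> * (G w / (w - z) * w)" by simp
    ultimately show ?thesis unfolding w_def by (simp only:)
  qed
  have "integral {0..2*pi} (\<lambda>t. \<i> * (poisson z (cis t) * F (cis t))) = 2 * of_real pi * \<i> * G z"
    using I unfolding eq by (rule integral_unique)
  then have "integral {0..2*pi} (\<lambda>t. poisson z (cis t) * F (cis t)) = 2 * of_real pi * G z"
    by simp
  moreover have "G z = F z" unfolding G_def using nz[of z] z by simp
  ultimately show ?thesis
    unfolding circle_mean_def by (simp add: scaleR_conv_of_real)
qed

lemma poisson_integral_Re:
  assumes F: "F holomorphic_on cball 0 1" and z: "norm z < 1"
  shows "circle_mean (\<lambda>w. poisson z w * Re (F w)) = Re (F z)"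
proof -
  have "continuous_on (sphere 0 1) F"
    using F by (meson continuous_on_subset holomorphic_on_imp_continuous_on sphere_cball)
  then have "continuous_on (sphere 0 1) (\<lambda>w. poisson z w * F w)"
    by (intro continuous_intros continuous_on_poisson z)
  from Re_circle_mean[OF this] poisson_integral_holomorphic[OF F z] show ?thesis
    by simp
qed

lemma circle_mean_poisson: "norm z < 1 \<Longrightarrow> circle_mean (poisson z) = 1"
  using poisson_integral_Re[of "\<lambda>_. 1" z] by simp

lemma circle_mean_holomorphic:
  assumes F: "F holomorphic_on cball 0 1"
  shows "circle_mean F = F 0"
  using poisson_integral_holomorphic[OF F, of 0]
  by (subst circle_mean_cong[of _ "\<lambda>w. poisson 0 w * F w"]) (auto simp: poisson_def)

section \<open>Subharmonicity of powers of the modulus\<close>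

lemma norm_mobius_identity:
  fixes a b :: complex
  shows "(norm (1 - cnj a * b))\<^sup>2 - (norm (b - a))\<^sup>2 = (1 - (norm a)\<^sup>2) * (1 - (norm b)\<^sup>2)"
  unfolding cmod_power2 by (simp add: power2_eq_square algebra_simps)

lemma norm_diff_le_mobius:
  fixes a b :: complex
  assumes "norm a \<le> 1" "norm b \<le> 1"
  shows "norm (b - a) \<le> norm (1 - cnj a * b)"
proof -
  have "0 \<le> (1 - (norm a)\<^sup>2) * (1 - (norm b)\<^sup>2)"
    using assms by (intro mult_nonneg_nonneg) (auto simp: power_le_one)
  then have "(norm (b - a))\<^sup>2 \<le> (norm (1 - cnj a * b))\<^sup>2"
    using norm_mobius_identity[of a b] by linarith
  then show ?thesis by (rule power2_le_imp_le) simp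
qed

(* Replace every root a in the disk by its reflection in the circle, i.e. z - a by 1 - cnj a z. *)
lemma poly_reflect_roots:
  fixes g :: "complex poly"
  assumes "g \<noteq> 0"
  obtains h where "\<And>z. norm z < 1 \<Longrightarrow> poly h z \<noteq> 0"
    and "\<And>z. norm z \<le> 1 \<Longrightarrow> norm (poly g z) \<le> norm (poly h z)"
    and "\<And>z. norm z = 1 \<Longrightarrow> norm (poly g z) = norm (poly h z)"
proof -
  have "\<exists>h. (\<forall>z. norm z < 1 \<longrightarrow> poly h z \<noteq> 0) \<and>
      (\<forall>z. norm z \<le> 1 \<longrightarrow> norm (poly g z) \<le> norm (poly h z)) \<and>
      (\<forall>z. norm z = 1 \<longrightarrow> norm (poly g z) = norm (poly h z))"
    using assms
  proof (induction "degree g" arbitrary: g rule: less_induct)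
    case less
    show ?case
    proof (cases "\<exists>a. norm a < 1 \<and> poly g a = 0")
      case False
      then show ?thesis by (intro exI[of _ g]) auto
    next
      case True
      then obtain a where a: "norm a < 1" "poly g a = 0" by blast
      then obtain g1 where g1: "g = [:-a, 1:] * g1"
        using poly_eq_0_iff_dvd by blast
      with less.prems have "g1 \<noteq> 0" by auto
      then have "degree g = Suc (degree g1)"
        unfolding g1 by (subst degree_mult_eq) auto
      with less.hyps[of g1] \<open>g1 \<noteq> 0\<close> obtain h where h:
        "\<And>z. norm z < 1 \<Longrightarrow> poly h z \<noteq> 0"
        "\<And>z. norm z \<le> 1 \<Longrightarrow> norm (poly g1 z) \<le> norm (poly h z)"
        "\<And>z. norm z = 1 \<Longrightarrow> norm (poly g1 z) = norm (poly h z)"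
        by auto
      have eval: "poly ([:1, - cnj a:] * h) z = (1 - cnj a * z) * poly h z"
        "poly g z = (z - a) * poly g1 z" for z
        by (auto simp: g1 algebra_simps)
      show ?thesis
      proof (intro exI[of _ "[:1, - cnj a:] * h"] conjI allI impI)
        fix z :: complex assume "norm z < 1"
        then show "poly ([:1, - cnj a:] * h) z \<noteq> 0"
          unfolding eval using h(1) one_minus_mult_neq_0[of "cnj a" z] a by simp
      next
        fix z :: complex assume z: "norm z \<le> 1"
        show "norm (poly g z) \<le> norm (poly ([:1, - cnj a:] * h) z)"
          unfolding eval norm_mult using a z
          by (intro mult_mono h norm_diff_le_mobius) auto
      next
        fix z :: complex assume z: "norm z = 1"
        then show "norm (poly g z) = norm (poly ([:1, - cnj a:] * h) z)"
          unfolding eval norm_mult using norm_diff_circle[OF z, of a] h(3)[OF z] by simp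
      qed
    qed
  qed
  then show ?thesis using that by blast
qed

text \<open>Uniform convergence survives the q-th power because eventually all values lie in one
  closed disk, where |x|^q is uniformly continuous. This carries the subharmonic inequality through
  dilations and through polynomial approximation.\<close>

lemma tendsto_poisson_mean_powr:
  fixes gs :: "'b \<Rightarrow> complex \<Rightarrow> complex"
  assumes lim: "uniform_limit (sphere 0 1) gs g F"
    and cont: "\<And>n. continuous_on (sphere 0 1) (gs n)" and F: "F \<noteq> bot" and "q > 0" "norm z < 1"
  shows "((\<lambda>n. circle_mean (\<lambda>w. poisson z w * norm (gs n w) powr q)) \<longlongrightarrow>
           circle_mean (\<lambda>w. poisson z w * norm (g w) powr q)) F"
proof (rule tendsto_circle_mean)
  let ?S = "sphere 0 1 :: complex set"
  have contg: "continuous_on ?S g"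
    using uniform_limit_theorem[OF _ lim] cont F by simp
  have cpow: "continuous_on A (\<lambda>x. norm x powr q)" for A :: "complex set"
    using \<open>q > 0\<close> by (intro continuous_on_powr' continuous_intros) auto
  have bdd: "bounded (f ` ?S)" if "continuous_on ?S f" for f :: "complex \<Rightarrow> 'c::metric_space"
    by (intro compact_imp_bounded compact_continuous_image that) auto
  obtain B where B: "\<And>w. w \<in> ?S \<Longrightarrow> norm (g w) \<le> B"
    using bdd[OF contg] unfolding bounded_iff by blast
  have ev: "\<forall>\<^sub>F n in F. \<forall>w\<in>?S. gs n w \<in> cball 0 (B + 1)"
    using uniform_limitD[OF lim zero_less_one]
  proof eventually_elim
    case (elim n)
    show ?case
    proof
      fix w assume w: "w \<in> ?S"
      have "norm (gs n w - g w) < 1" using elim w by (auto simp: dist_norm)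
      then show "gs n w \<in> cball 0 (B + 1)"
        using B[OF w] norm_triangle_ineq2[of "gs n w" "g w"] by (auto simp: dist_norm)
    qed
  qed
  have "uniform_limit ?S (\<lambda>n w. norm (gs n w) powr q) (\<lambda>w. norm (g w) powr q) F"
    using compact_uniformly_continuous[OF cpow compact_cball] ev
    by (rule uniform_limit_compose_uniformly_continuous_on[OF lim]) simp
  moreover have "uniform_limit ?S (\<lambda>n. poisson z) (poisson z) F"
    by (rule uniform_limit_const)
  moreover have "continuous_on ?S (\<lambda>w. norm (g w) powr q)"
    using \<open>q > 0\<close> by (intro continuous_on_powr' continuous_intros contg) auto
  ultimately show "uniform_limit ?S (\<lambda>n w. poisson z w * norm (gs n w) powr q)
      (\<lambda>w. poisson z w * norm (g w) powr q) F"
    using bdd continuous_on_poisson[OF \<open>norm z < 1\<close>] by (intro uniform_lim_mult) auto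
  show "\<forall>\<^sub>F n in F. continuous_on ?S (\<lambda>w. poisson z w * norm (gs n w) powr q)"
    using \<open>q > 0\<close> continuous_on_poisson[OF \<open>norm z < 1\<close>]
    by (intro always_eventually allI continuous_on_mult continuous_on_powr' continuous_intros cont) auto
qed (rule F)

text \<open>Reflecting the roots keeps the right side and can only increase the left one, so the
  polynomial may be taken zero-free in the disk. Then it has a logarithm L, its q-th power is the
  modulus of exp(q L), and the Poisson formula with the triangle inequality gives the claim.\<close>

lemma powr_le_poisson_mean_poly:
  fixes g :: "complex poly"
  assumes "q > 0" "norm z < 1"
  shows "norm (poly g z) powr q \<le> circle_mean (\<lambda>w. poisson z w * norm (poly g w) powr q)"
proof (cases "g = 0")
  case False
  then obtain h where h: "\<And>z. norm z < 1 \<Longrightarrow> poly h z \<noteq> 0"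
    "\<And>z. norm z \<le> 1 \<Longrightarrow> norm (poly g z) \<le> norm (poly h z)"
    "\<And>z. norm z = 1 \<Longrightarrow> norm (poly g z) = norm (poly h z)"
    using poly_reflect_roots by blast
  \<comment> \<open>Zeros of \<open>h\<close> on the unit circle remain possible; for r < 1 the
    dilated polynomial has none in the closed disk, and r tends to 1 afterwards.\<close>
  have dil: "norm (poly h (of_real r * z)) powr q
      \<le> circle_mean (\<lambda>w. poisson z w * norm (poly h (of_real r * w)) powr q)"
    if r: "0 < r" "r < 1" for r
  proof -
    have "(\<lambda>w. poly h (of_real r * w)) holomorphic_on cball 0 1"
      by (intro holomorphic_intros)
    moreover have "poly h (of_real r * w) \<noteq> 0" if "w \<in> cball 0 1" for w
    proof (rule h)
      have "r * norm w \<le> r * 1" using that r by (intro mult_left_mono) auto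
      also have "\<dots> < 1" using r by simp
      finally show "norm (complex_of_real r * w) < 1" using r by (simp add: norm_mult)
    qed
    ultimately obtain L where L: "L holomorphic_on cball 0 1"
      "\<And>w. w \<in> cball 0 1 \<Longrightarrow> poly h (of_real r * w) = exp (L w)"
      using contractible_imp_holomorphic_log[of _ "cball 0 1"] convex_imp_contractible[OF convex_cball]
      by metis
    have eq: "norm (poly h (of_real r * w)) powr q = norm (exp (of_real q * L w))" if "norm w \<le> 1" for w
      using L(2)[of w] that by (simp add: powr_def)
    have hol: "(\<lambda>w. exp (of_real q * L w)) holomorphic_on cball 0 1"
      by (intro holomorphic_intros L)
    then have cont: "continuous_on (sphere 0 1) (\<lambda>w. exp (of_real q * L w))"
      by (meson continuous_on_subset holomorphic_on_imp_continuous_on sphere_cball)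
    have "norm (exp (of_real q * L z))
        = norm (circle_mean (\<lambda>w. complex_of_real (poisson z w) * exp (of_real q * L w)))"
      using poisson_integral_holomorphic[OF hol \<open>norm z < 1\<close>] by simp
    also have "\<dots> \<le> circle_mean (\<lambda>w. norm (complex_of_real (poisson z w) * exp (of_real q * L w)))"
      using cont continuous_on_poisson[OF \<open>norm z < 1\<close>]
      by (intro norm_circle_mean_le continuous_on_mult continuous_on_of_real) auto
    also have "\<dots> = circle_mean (\<lambda>w. poisson z w * norm (poly h (of_real r * w)) powr q)"
    proof (rule circle_mean_cong)
      fix w :: complex assume "norm w = 1"
      then show "norm (complex_of_real (poisson z w) * exp (of_real q * L w))
          = poisson z w * norm (poly h (of_real r * w)) powr q"
        using eq[of w] poisson_nonneg[OF \<open>norm z < 1\<close>, of w] by (simp add: norm_mult)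
    qed
    finally show ?thesis using eq[of z] \<open>norm z < 1\<close> by simp
  qed
  have lim: "uniform_limit (sphere 0 1) (\<lambda>r w. poly h (of_real r * w)) (poly h) (at_left 1)"
  proof (rule uniform_limit_compose_uniformly_continuous_on[where B = "cball 0 1" and f = "poly h"
        and g = "\<lambda>r w. complex_of_real r * w" and g' = "\<lambda>w. w"])
    show "uniform_limit (sphere 0 1) (\<lambda>r w. complex_of_real r * w) (\<lambda>w. w) (at_left 1)"
    proof (rule uniform_limitI)
      fix e :: real assume "e > 0"
      then have "\<forall>\<^sub>F r in at_left 1. dist r 1 < e"
        by (auto simp: eventually_at)
      then show "\<forall>\<^sub>F r in at_left 1. \<forall>w\<in>sphere 0 1. dist (complex_of_real r * w) w < e"
      proof eventually_elim
        case (elim r)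
        have "complex_of_real r * w - w = of_real (r - 1) * w" for w
          by (simp add: algebra_simps)
        then have "norm (complex_of_real r * w - w) = \<bar>r - 1\<bar> * norm w" for w
          by (simp only: norm_mult norm_of_real)
        with elim show ?case by (auto simp: dist_norm)
      qed
    qed
    show "uniformly_continuous_on (cball 0 1) (poly h)"
      by (intro compact_uniformly_continuous continuous_intros) auto
    have "\<forall>\<^sub>F r in at_left (1::real). r \<in> {0<..<1}"
      by (rule eventually_at_left_real) simp
    then show "\<forall>\<^sub>F r in at_left 1. \<forall>w\<in>sphere 0 1. complex_of_real r * w \<in> cball 0 1"
      by eventually_elim (auto simp: norm_mult)
  qed auto
  have "((\<lambda>r. norm (poly h (complex_of_real r * z)) powr q) \<longlongrightarrow> norm (poly h (complex_of_real 1 * z)) powr q) (at_left 1)"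
    by (intro tendsto_powr' tendsto_intros isCont_tendsto_compose[of _ "poly h"]) (use \<open>q > 0\<close> in auto)
  moreover have "((\<lambda>r. circle_mean (\<lambda>w. poisson z w * norm (poly h (of_real r * w)) powr q)) \<longlongrightarrow>
      circle_mean (\<lambda>w. poisson z w * norm (poly h w) powr q)) (at_left 1)"
    by (rule tendsto_poisson_mean_powr[OF lim _ _ assms]) (auto intro!: continuous_intros)
  moreover have "\<forall>\<^sub>F r in at_left (1::real). r \<in> {0<..<1}"
    by (rule eventually_at_left_real) simp
  then have "\<forall>\<^sub>F r in at_left 1. norm (poly h (of_real r * z)) powr q
      \<le> circle_mean (\<lambda>w. poisson z w * norm (poly h (of_real r * w)) powr q)"
    by eventually_elim (use dil in auto)
  ultimately have "norm (poly h (complex_of_real 1 * z)) powr q \<le> circle_mean (\<lambda>w. poisson z w * norm (poly h w) powr q)"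
    by (intro tendsto_le[of "at_left (1::real)"]) auto
  moreover have "norm (poly g z) powr q \<le> norm (poly h z) powr q"
    using h(2)[of z] assms by (intro powr_mono2) auto
  moreover have "circle_mean (\<lambda>w. poisson z w * norm (poly h w) powr q)
      = circle_mean (\<lambda>w. poisson z w * norm (poly g w) powr q)"
    by (rule circle_mean_cong) (use h(3) in simp)
  ultimately show ?thesis by simp
qed simp

lemma taylor_polys_uniform_limit:
  assumes g: "g holomorphic_on ball 0 R" and "R > 1"
  obtains P :: "nat \<Rightarrow> complex poly" where "uniform_limit (cball 0 1) (\<lambda>n. poly (P n)) g sequentially"
proof
  define a where "a = (\<lambda>n. (deriv ^^ n) g 0 / fact n)"
  have sums: "(\<lambda>n. a n * w ^ n) sums g w" if "norm w < R" for w
    using holomorphic_power_series[OF g, of w] that unfolding a_def by simp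
  have "conv_radius a \<ge> R"
  proof (rule conv_radius_geI_ex')
    fix r :: real assume "0 < r" "ereal r < ereal R"
    then show "summable (\<lambda>n. a n * complex_of_real r ^ n)"
      using sums[of "of_real r"] by (auto simp: sums_iff)
  qed
  then have "ereal 1 < conv_radius a"
    using \<open>R > 1\<close> by (meson ereal_less_eq(3) less_ereal.simps(1) less_le_trans)
  from powser_uniform_limit[OF this, of 0]
  have *: "uniform_limit (cball 0 1) (\<lambda>n x. \<Sum>i<n. a i * x ^ i) (\<lambda>x. \<Sum>i. a i * x ^ i) sequentially"
    by simp
  show "uniform_limit (cball 0 1) (\<lambda>n. poly (\<Sum>i<n. monom (a i) i)) g sequentially"
    by (rule uniform_limit_cong'[THEN iffD1, OF _ _ *])
       (use sums \<open>R > 1\<close> in \<open>auto simp: poly_sum poly_monom sums_iff\<close>)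
qed

text \<open>Taylor polynomials converge uniformly up to the circle because R > 1, so only
  polynomials ever need their zeros factored out.\<close>

lemma powr_le_poisson_mean:
  assumes g: "g holomorphic_on ball 0 R" and "R > 1" and "q > 0" "norm z < 1"
  shows "norm (g z) powr q \<le> circle_mean (\<lambda>w. poisson z w * norm (g w) powr q)"
proof -
  obtain P where P: "uniform_limit (cball 0 1) (\<lambda>n. poly (P n)) g sequentially"
    using taylor_polys_uniform_limit[OF g \<open>R > 1\<close>] .
  have "(\<lambda>n. circle_mean (\<lambda>w. poisson z w * norm (poly (P n) w) powr q)) \<longlonglongrightarrow>
      circle_mean (\<lambda>w. poisson z w * norm (g w) powr q)"
    by (rule tendsto_poisson_mean_powr[OF _ _ _ \<open>q > 0\<close> \<open>norm z < 1\<close>])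
       (auto intro!: continuous_intros uniform_limit_on_subset[OF P])
  moreover have "(\<lambda>n. norm (poly (P n) z) powr q) \<longlonglongrightarrow> norm (g z) powr q"
    by (intro tendsto_powr' tendsto_intros tendsto_uniform_limitI[OF P]) (use assms in auto)
  ultimately show ?thesis
    using powr_le_poisson_mean_poly[OF \<open>q > 0\<close> \<open>norm z < 1\<close>] by (intro LIMSEQ_le) auto
qed

section \<open>The Carleson embedding\<close>

lemma norm_one_minus_cnj_commute:
  fixes a b :: complex
  shows "norm (1 - cnj a * b) = norm (1 - cnj b * a)"
proof -
  have "norm (1 - cnj a * b) = norm (cnj (1 - cnj a * b))" by (simp only: complex_mod_cnj)
  then show ?thesis by (simp add: mult.commute)
qed

text \<open>|1 - cnj s * t| behaves like a distance on the closed disk; after squaring, at the cost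
  of a factor 2, this is the quasi-triangle inequality required by
  \<open>vinogradov_senichkin\<close>.\<close>

lemma norm_one_minus_triangle:
  fixes s t x :: complex
  assumes "norm s \<le> 1" "norm t \<le> 1" "norm x \<le> 1"
  shows "norm (1 - cnj s * t) \<le> norm (1 - cnj x * s) + norm (1 - cnj x * t)"
proof -
  have "1 - cnj s * t = (1 - cnj x * t) - cnj (s - x) * t"
    by (simp add: algebra_simps)
  then have "norm (1 - cnj s * t) \<le> norm (1 - cnj x * t) + norm (cnj (s - x) * t)"
    by (simp only: norm_triangle_ineq4)
  also have "norm (cnj (s - x) * t) = norm (s - x) * norm t"
    by (simp only: norm_mult complex_mod_cnj)
  also have "\<dots> \<le> norm (s - x)"
    using assms mult_left_mono[of "norm t" 1 "norm (s - x)"] by simp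
  also have "\<dots> \<le> norm (1 - cnj x * s)"
    using norm_diff_le_mobius assms by blast
  finally show ?thesis by simp
qed

text \<open>One kernel is read as the boundary values of the real part of a holomorphic function,
  and the other evaluates that real part at a point. The result is the Gram matrix of Poisson
  kernels in L^2 of the circle.\<close>

lemma circle_mean_poisson_poisson:
  assumes "norm a < 1" "norm b < 1"
  shows "circle_mean (\<lambda>w. poisson a w * poisson b w)
    = (1 - (norm a * norm b)\<^sup>2) / (norm (1 - cnj a * b))\<^sup>2"
proof -
  have nz: "1 - cnj b * w \<noteq> 0" if "norm w \<le> 1" for w
    using one_minus_mult_neq_0[of "cnj b" w] assms that by simp
  have "circle_mean (\<lambda>w. poisson a w * poisson b w)
    = circle_mean (\<lambda>w. poisson a w * Re ((1 + cnj b * w) / (1 - cnj b * w)))"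
    by (rule circle_mean_cong) (simp add: poisson_eq_Re assms)
  also have "\<dots> = Re ((1 + cnj b * a) / (1 - cnj b * a))"
    by (rule poisson_integral_Re[OF _ \<open>norm a < 1\<close>], intro holomorphic_intros) (use nz in auto)
  also have "\<dots> = (1 - (norm (cnj b * a))\<^sup>2) / (norm (1 - cnj b * a))\<^sup>2"
    by (rule Re_cayley) (use nz assms in auto)
  finally show ?thesis by (simp add: norm_mult norm_one_minus_cnj_commute[of b a] mult.commute[of "norm a"])
qed

(* The Vinogradov-Senichkin test: with (K y)_i = sum_k m_k y_k (m_k / D i k), the quasi-triangle
   inequality for D gives |K y|^2 <= 4 M <y, K y> in the l^2 space with weights m. *)
lemma vinogradov_senichkin:
  fixes m y :: "'i \<Rightarrow> real" and D :: "'i \<Rightarrow> 'i \<Rightarrow> real"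
  assumes J: "finite J" and m: "\<And>i. i \<in> J \<Longrightarrow> m i \<ge> 0" and y: "\<And>i. i \<in> J \<Longrightarrow> y i \<ge> 0"
    and D: "\<And>i k. i \<in> J \<Longrightarrow> k \<in> J \<Longrightarrow> D i k > 0"
    and sym: "\<And>i k. i \<in> J \<Longrightarrow> k \<in> J \<Longrightarrow> D i k = D k i"
    and tri: "\<And>i k l. i \<in> J \<Longrightarrow> k \<in> J \<Longrightarrow> l \<in> J \<Longrightarrow> D i k \<le> 2 * (D l i + D l k)"
    and M: "\<And>i. i \<in> J \<Longrightarrow> (\<Sum>k\<in>J. m i * m k / D i k) \<le> M" and "M > 0"
  shows "(\<Sum>i\<in>J. \<Sum>k\<in>J. m i * y i * (m k * y k) * ((m i + m k) / D i k)) \<le> 8 * M * (\<Sum>i\<in>J. m i * (y i)\<^sup>2)"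
proof -
  define K where "K = (\<lambda>i. \<Sum>k\<in>J. m k * y k * (m k / D i k))"
  define S where "S = (\<Sum>i\<in>J. m i * y i * K i)"
  define N where "N = (\<Sum>i\<in>J. m i * (K i)\<^sup>2)"
  define Y where "Y = (\<Sum>i\<in>J. m i * (y i)\<^sup>2)"
  have K0: "K i \<ge> 0" if "i \<in> J" for i
    unfolding K_def using m y D that by (intro sum_nonneg mult_nonneg_nonneg divide_nonneg_pos) auto
  have "N \<ge> 0" "Y \<ge> 0" "S \<ge> 0"
    unfolding N_def Y_def S_def using m y K0 by (auto intro!: sum_nonneg)
  have sum_x: "(\<Sum>x\<in>J. m x * (m s * m t / (D x s * D x t))) \<le> 2 * M * ((m s + m t) / D s t)"
    if s: "s \<in> J" and t: "t \<in> J" for s t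
  proof -
    have "(\<Sum>x\<in>J. m x * (m s * m t / (D x s * D x t)))
        \<le> (\<Sum>x\<in>J. 2 / D s t * (m t * (m s * m x / D s x) + m s * (m t * m x / D t x)))"
    proof (rule sum_mono)
      fix x assume x: "x \<in> J"
      have pos: "D x s > 0" "D x t > 0" "D s t > 0" using D s t x by auto
      \<comment> \<open>The quasi-triangle inequality divided by the product of all three
        quantities: a product of two kernels through x splits into single kernels, with 1 / D s t as
        a factor free of x. Summation over x can then use the hypothesis on M twice.\<close>
      have "1 / (D x s * D x t) \<le> 2 / D s t * (1 / D x s + 1 / D x t)"
        using tri[OF s t x] pos by (simp add: field_simps)
      then have "m x * (m s * m t) * (1 / (D x s * D x t))
          \<le> m x * (m s * m t) * (2 / D s t * (1 / D x s + 1 / D x t))"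
        using m s t x by (intro mult_left_mono) auto
      then show "m x * (m s * m t / (D x s * D x t))
          \<le> 2 / D s t * (m t * (m s * m x / D s x) + m s * (m t * m x / D t x))"
        using sym[OF s x] sym[OF t x] by (simp add: algebra_simps)
    qed
    also have "\<dots> = 2 / D s t * (m t * (\<Sum>x\<in>J. m s * m x / D s x) + m s * (\<Sum>x\<in>J. m t * m x / D t x))"
      by (simp add: sum_distrib_left sum.distrib algebra_simps)
    also have "\<dots> \<le> 2 / D s t * (m t * M + m s * M)"
      using D[OF s t] m s t by (intro mult_left_mono add_mono M) auto
    finally show ?thesis by (simp add: algebra_simps add_divide_distrib)
  qed
  have "N = (\<Sum>x\<in>J. \<Sum>s\<in>J. \<Sum>t\<in>J. m s * y s * (m t * y t) * (m x * (m s * m t / (D x s * D x t))))"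
    unfolding N_def K_def power2_eq_square sum_product unfolding sum_distrib_left
    by (intro sum.cong refl) (simp add: mult_ac)
  also have "\<dots> = (\<Sum>s\<in>J. \<Sum>t\<in>J. \<Sum>x\<in>J. m s * y s * (m t * y t) * (m x * (m s * m t / (D x s * D x t))))"
    by (subst sum.swap) (intro sum.cong refl sum.swap)
  also have "\<dots> \<le> (\<Sum>s\<in>J. \<Sum>t\<in>J. m s * y s * (m t * y t) * (2 * M * ((m s + m t) / D s t)))"
    unfolding sum_distrib_left[symmetric]
    by (intro sum_mono mult_left_mono sum_x mult_nonneg_nonneg m y) auto
  also have "\<dots> = 2 * M * (\<Sum>s\<in>J. \<Sum>t\<in>J. m s * y s * (m t * y t) * ((m s + m t) / D s t))"
    by (simp add: sum_distrib_left mult_ac)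
  \<comment> \<open>Exchanging the two indices swaps m s and m t in the kernel, so each half of the
    symmetrized form equals \<open>S\<close>.\<close>
  also have dbl: "(\<Sum>s\<in>J. \<Sum>t\<in>J. m s * y s * (m t * y t) * ((m s + m t) / D s t)) = 2 * S"
  proof -
    have "S = (\<Sum>s\<in>J. \<Sum>t\<in>J. m s * y s * (m t * y t) * (m t / D s t))"
      unfolding S_def K_def sum_distrib_left by (intro sum.cong refl) (simp add: mult_ac)
    moreover from this have "S = (\<Sum>s\<in>J. \<Sum>t\<in>J. m t * y t * (m s * y s) * (m s / D t s))"
      by (subst sum.swap) simp
    then have "S = (\<Sum>s\<in>J. \<Sum>t\<in>J. m s * y s * (m t * y t) * (m s / D s t))"
      using sym by (simp add: mult_ac)
    ultimately have "2 * S = (\<Sum>s\<in>J. \<Sum>t\<in>J. m s * y s * (m t * y t) * (m s / D s t))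
        + (\<Sum>s\<in>J. \<Sum>t\<in>J. m s * y s * (m t * y t) * (m t / D s t))"
      by linarith
    then show ?thesis
      by (simp add: sum.distrib[symmetric] add_divide_distrib distrib_left)
  qed
  finally have N: "N \<le> 4 * M * S" by simp
  (* AM-GM: 2 y K <= 4 M y^2 + K^2 / (4 M) *)
  have "8 * M * S \<le> (\<Sum>i\<in>J. m i * (16 * M\<^sup>2 * (y i)\<^sup>2 + (K i)\<^sup>2))"
    unfolding S_def sum_distrib_left
  proof (rule sum_mono)
    fix i assume i: "i \<in> J"
    have "0 \<le> (4 * M * y i - K i)\<^sup>2" by simp
    then have "8 * M * (y i * K i) \<le> 16 * M\<^sup>2 * (y i)\<^sup>2 + (K i)\<^sup>2"
      by (simp add: power2_eq_square algebra_simps)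
    from mult_left_mono[OF this m[OF i]]
    show "8 * M * (m i * y i * K i) \<le> m i * (16 * M\<^sup>2 * (y i)\<^sup>2 + (K i)\<^sup>2)"
      by (simp add: mult_ac)
  qed
  also have "\<dots> = 16 * M\<^sup>2 * Y + N"
    unfolding Y_def N_def by (simp add: sum_distrib_left sum.distrib algebra_simps)
  \<comment> \<open>The bound on \<open>N\<close> returns only half of the left side, which is
    therefore absorbed.\<close>
  finally have "8 * M * S \<le> 16 * M\<^sup>2 * Y + 4 * M * S" using N by linarith
  then have "M * S \<le> M * (4 * M * Y)" by (simp add: power2_eq_square)
  then have "S \<le> 4 * M * Y" using \<open>M > 0\<close> by simp
  then show ?thesis unfolding dbl Y_def[symmetric] by simp
qed

text \<open>With \<open>W\<close> the values of |g|^(p/2) at the points and \<open>G\<close> the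
  same function on the circle, subharmonicity bounds the left side \<open>Q\<close> by the L^2
  pairing of \<open>K\<close> with \<open>G\<close>. The squared norm of \<open>K\<close> is a
  quadratic form in \<open>W\<close> governed by the Gram matrix of Poisson kernels, hence at most 8
  M Q. Passing to the power p/2 makes this Hilbert space argument serve every p.\<close>

lemma carleson_embedding_closed_disk:
  fixes u :: "'i \<Rightarrow> complex"
  assumes J: "finite J" and u: "\<And>j. j \<in> J \<Longrightarrow> norm (u j) < 1"
    and M: "\<And>i. i \<in> J \<Longrightarrow>
      (\<Sum>k\<in>J. (1 - (norm (u i))\<^sup>2) * (1 - (norm (u k))\<^sup>2) / (norm (1 - cnj (u i) * u k))\<^sup>2) \<le> M"
    and "M > 0" "p > 0" and g: "g holomorphic_on ball 0 R" and "R > 1"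
  shows "(\<Sum>j\<in>J. (1 - (norm (u j))\<^sup>2) * norm (g (u j)) powr p)
    \<le> 8 * M * circle_mean (\<lambda>w. norm (g w) powr p)"
proof -
  define m where "m = (\<lambda>j. 1 - (norm (u j))\<^sup>2)"
  define D where "D = (\<lambda>i k. (norm (1 - cnj (u i) * u k))\<^sup>2)"
  define W where "W = (\<lambda>j. norm (g (u j)) powr (p / 2))"
  define G where "G = (\<lambda>w. norm (g w) powr (p / 2))"
  define K where "K = (\<lambda>w. \<Sum>j\<in>J. m j * W j * poisson (u j) w)"
  define Q where "Q = (\<Sum>j\<in>J. m j * (W j)\<^sup>2)"
  have m0: "m j \<ge> 0" if "j \<in> J" for j
    unfolding m_def using u[OF that] by (simp add: power_le_one)
  have W0: "W j \<ge> 0" for j by (simp add: W_def)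
  have sq: "(x powr (p / 2))\<^sup>2 = x powr p" if "x \<ge> 0" for x :: real
    using that by (simp add: power2_eq_square powr_add[symmetric])
  have contg: "continuous_on (sphere 0 1) g"
    using \<open>R > 1\<close> by (intro holomorphic_on_imp_continuous_on holomorphic_on_subset[OF g]) auto
  have contG: "continuous_on (sphere 0 1) G"
    unfolding G_def using \<open>p > 0\<close> by (intro continuous_on_powr' continuous_intros contg) auto
  have contP: "continuous_on (sphere 0 1) (poisson (u j))" if "j \<in> J" for j
    by (rule continuous_on_poisson[OF u[OF that]])
  have contK: "continuous_on (sphere 0 1) K"
    unfolding K_def by (intro continuous_intros contP)
  have "Q \<le> (\<Sum>j\<in>J. m j * W j * circle_mean (\<lambda>w. poisson (u j) w * G w))"
    unfolding Q_def power2_eq_square mult.assoc[symmetric]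
    by (intro sum_mono mult_left_mono mult_nonneg_nonneg m0 W0)
       (use powr_le_poisson_mean[OF g \<open>R > 1\<close>, of "p / 2"] \<open>p > 0\<close> u in \<open>auto simp: W_def G_def\<close>)
  also have "\<dots> = circle_mean (\<lambda>w. \<Sum>j\<in>J. m j * W j * (poisson (u j) w * G w))"
    by (subst circle_mean_sum[OF J])
       (auto intro!: continuous_intros contP contG simp: circle_mean_mult_left)
  also have "\<dots> = circle_mean (\<lambda>w. K w * G w)"
    unfolding K_def sum_distrib_right by (simp only: mult.assoc)
  \<comment> \<open>The weights anticipate the bound 8 M Q for the mean of K^2: the first term
    becomes Q / 2 and is absorbed at the end.\<close>
  also have "\<dots> \<le> circle_mean (\<lambda>w. 1 / (16 * M) * (K w)\<^sup>2 + 4 * M * (G w)\<^sup>2)"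
  proof (rule circle_mean_mono)
    fix w
    have "0 \<le> (K w - 8 * M * G w)\<^sup>2" by simp
    then have "16 * M * (K w * G w) \<le> (K w)\<^sup>2 + 64 * M\<^sup>2 * (G w)\<^sup>2"
      by (simp add: power2_eq_square algebra_simps)
    then show "K w * G w \<le> 1 / (16 * M) * (K w)\<^sup>2 + 4 * M * (G w)\<^sup>2"
      using \<open>M > 0\<close> by (simp add: field_simps power2_eq_square)
  qed (intro continuous_intros contK contG)+
  also have "\<dots> = 1 / (16 * M) * circle_mean (\<lambda>w. (K w)\<^sup>2) + 4 * M * circle_mean (\<lambda>w. (G w)\<^sup>2)"
  proof -
    have "continuous_on (sphere 0 1) (\<lambda>w. 1 / (16 * M) * (K w)\<^sup>2)"
      "continuous_on (sphere 0 1) (\<lambda>w. 4 * M * (G w)\<^sup>2)"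
      by (intro continuous_intros contK contG)+
    then show ?thesis by (simp only: circle_mean_add circle_mean_mult_left)
  qed
  also have "circle_mean (\<lambda>w. (G w)\<^sup>2) = circle_mean (\<lambda>w. norm (g w) powr p)"
    by (simp add: G_def sq)
  also have "circle_mean (\<lambda>w. (K w)\<^sup>2) =
      (\<Sum>i\<in>J. \<Sum>k\<in>J. m i * W i * (m k * W k) * circle_mean (\<lambda>w. poisson (u i) w * poisson (u k) w))"
  proof -
    have "(K w)\<^sup>2 = (\<Sum>i\<in>J. \<Sum>k\<in>J. m i * W i * (m k * W k) * (poisson (u i) w * poisson (u k) w))" for w
      unfolding K_def power2_eq_square sum_product by (intro sum.cong refl) (simp add: mult_ac)
    then show ?thesis
      by (simp add: circle_mean_sum[OF J] continuous_on_sum continuous_on_mult_left continuous_on_mult contP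
          circle_mean_mult_left)
  qed
  also have "\<dots> \<le> (\<Sum>i\<in>J. \<Sum>k\<in>J. m i * W i * (m k * W k) * ((m i + m k) / D i k))"
  proof (intro sum_mono mult_left_mono mult_nonneg_nonneg m0 W0)
    fix i k assume ik: "i \<in> J" "k \<in> J"
    \<comment> \<open>This replaces the numerators of the Gram matrix by m i + m k, the form that
      \<open>vinogradov_senichkin\<close> handles.\<close>
    have "1 - x * y \<le> (1 - x) + (1 - y)" if "x \<le> 1" "y \<le> 1" for x y :: real
      using mult_nonneg_nonneg[of "1 - x" "1 - y"] that by (simp add: algebra_simps)
    from this[of "(norm (u i))\<^sup>2" "(norm (u k))\<^sup>2"]
    have "1 - (norm (u i) * norm (u k))\<^sup>2 \<le> m i + m k"
      using u[OF ik(1)] u[OF ik(2)] by (simp add: m_def power_mult_distrib power_le_one)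
    then show "circle_mean (\<lambda>w. poisson (u i) w * poisson (u k) w) \<le> (m i + m k) / D i k"
      using circle_mean_poisson_poisson[OF u u, OF ik] by (simp add: D_def divide_right_mono)
  qed
  also have "\<dots> \<le> 8 * M * Q"
    unfolding Q_def
  proof (rule vinogradov_senichkin[OF J _ _ _ _ _ _ \<open>M > 0\<close>])
    fix i k assume ik: "i \<in> J" "k \<in> J"
    show "D i k > 0"
      unfolding D_def using one_minus_mult_neq_0[of "cnj (u i)" "u k"] u[OF ik(1)] u[OF ik(2)] by auto
    show "D i k = D k i"
      unfolding D_def by (simp only: norm_one_minus_cnj_commute)
    fix l assume l: "l \<in> J"
    have "(x + y)\<^sup>2 \<le> 2 * (x\<^sup>2 + y\<^sup>2)" for x y :: real
      using sum_squares_bound[of x y] by (simp add: power2_sum)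
    moreover have "D i k \<le> (norm (1 - cnj (u l) * u i) + norm (1 - cnj (u l) * u k))\<^sup>2"
      unfolding D_def using u[OF ik(1)] u[OF ik(2)] u[OF l]
      by (intro power_mono norm_one_minus_triangle) auto
    ultimately show "D i k \<le> 2 * (D l i + D l k)"
      unfolding D_def by (meson order_trans)
  qed (use m0 W0 M in \<open>auto simp: m_def D_def\<close>)
  finally have "Q \<le> 1 / (16 * M) * (8 * M * Q) + 4 * M * circle_mean (\<lambda>w. norm (g w) powr p)"
    using \<open>M > 0\<close> by (simp add: divide_right_mono)
  then have "Q \<le> 8 * M * circle_mean (\<lambda>w. norm (g w) powr p)"
    using \<open>M > 0\<close> by simp
  then show ?thesis
    unfolding Q_def W_def m_def by (simp add: sq)
qed

text \<open>Each dilation g(r w) is holomorphic on the disk of radius 1 / r > 1, where the preceding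
  estimate applies. The left side involves finitely many interior points, so continuity of
  \<open>g\<close> there suffices to let r tend to 1.\<close>

lemma carleson_embedding:
  fixes u :: "'i \<Rightarrow> complex"
  assumes J: "finite J" and u: "\<And>j. j \<in> J \<Longrightarrow> norm (u j) < 1"
    and M: "\<And>i. i \<in> J \<Longrightarrow>
      (\<Sum>k\<in>J. (1 - (norm (u i))\<^sup>2) * (1 - (norm (u k))\<^sup>2) / (norm (1 - cnj (u i) * u k))\<^sup>2) \<le> M"
    and "M > 0" "p > 0" and g: "g holomorphic_on ball 0 1"
    and N: "\<And>r. 0 < r \<Longrightarrow> r < 1 \<Longrightarrow> circle_mean (\<lambda>w. norm (g (of_real r * w)) powr p) \<le> N"
  shows "(\<Sum>j\<in>J. (1 - (norm (u j))\<^sup>2) * norm (g (u j)) powr p) \<le> 8 * M * N"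
proof (rule tendsto_upperbound)
  have "((\<lambda>r. \<Sum>j\<in>J. (1 - (norm (u j))\<^sup>2) * norm (g (of_real r * u j)) powr p) \<longlongrightarrow>
      (\<Sum>j\<in>J. (1 - (norm (u j))\<^sup>2) * norm (g (of_real 1 * u j)) powr p)) (at_left 1)"
  proof (intro tendsto_sum tendsto_mult tendsto_const tendsto_powr' tendsto_norm)
    fix j assume "j \<in> J"
    have "isCont g (of_real 1 * u j)"
      using g u[OF \<open>j \<in> J\<close>]
      by (intro continuous_on_interior[OF holomorphic_on_imp_continuous_on]) auto
    then show "((\<lambda>r. g (of_real r * u j)) \<longlongrightarrow> g (of_real 1 * u j)) (at_left 1)"
      by (rule isCont_tendsto_compose) (intro tendsto_intros)
  qed (use \<open>p > 0\<close> in auto)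
  then show "((\<lambda>r. \<Sum>j\<in>J. (1 - (norm (u j))\<^sup>2) * norm (g (of_real r * u j)) powr p) \<longlongrightarrow>
      (\<Sum>j\<in>J. (1 - (norm (u j))\<^sup>2) * norm (g (u j)) powr p)) (at_left 1)"
    by simp
  have "\<forall>\<^sub>F r in at_left (1::real). r \<in> {0<..<1}"
    by (rule eventually_at_left_real) simp
  then show "\<forall>\<^sub>F r in at_left 1. (\<Sum>j\<in>J. (1 - (norm (u j))\<^sup>2) * norm (g (of_real r * u j)) powr p) \<le> 8 * M * N"
  proof eventually_elim
    case (elim r)
    then have r: "0 < r" "r < 1" by auto
    have "(\<lambda>w. g (complex_of_real r * w)) holomorphic_on ball 0 (1 / r)"
    proof (rule holomorphic_on_compose_gen[OF _ g, unfolded o_def])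
      show "(\<lambda>w. complex_of_real r * w) ` ball 0 (1 / r) \<subseteq> ball 0 1"
        using r by (auto simp: dist_norm norm_mult field_simps)
    qed (intro holomorphic_intros)
    from carleson_embedding_closed_disk[OF J u M \<open>M > 0\<close> \<open>p > 0\<close> this]
    have "(\<Sum>j\<in>J. (1 - (norm (u j))\<^sup>2) * norm (g (of_real r * u j)) powr p)
        \<le> 8 * M * circle_mean (\<lambda>w. norm (g (of_real r * w)) powr p)"
      using r by simp
    also have "\<dots> \<le> 8 * M * N"
      using N[OF r] \<open>M > 0\<close> by (intro mult_left_mono) auto
    finally show ?case .
  qed
qed simp

section \<open>From the separation constant to the Carleson constant\<close>

lemma norm_mobius_quotient:
  fixes a b :: complex
  assumes "norm a < 1" "norm b < 1"
  shows "1 - (norm ((a - b) / (1 - cnj a * b)))\<^sup>2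
    = (1 - (norm a)\<^sup>2) * (1 - (norm b)\<^sup>2) / (norm (1 - cnj a * b))\<^sup>2"
proof -
  have "norm (1 - cnj a * b) \<noteq> 0"
    using one_minus_mult_neq_0[of "cnj a" b] assms by simp
  then show ?thesis
    using norm_mobius_identity[of a b]
    by (simp add: norm_divide power_divide norm_minus_commute[of a] field_simps)
qed

lemma uniform_separation_constant_le:
  assumes "i \<in> {1..n}"
  shows "uniform_separation_constant n u \<le> (\<Prod>k\<in>{1..n} - {i}. norm ((u i - u k) / (1 - cnj (u i) * u k)))"
  unfolding uniform_separation_constant_def by (rule cINF_lower) (use assms in auto)

text \<open>The infimum runs over a finite nonempty index set and is attained, so it inherits
  positivity from the individual products; the logarithm of its inverse is then finite and
  nonnegative.\<close>

lemma uniform_separation_constant_bounds: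
  assumes "n \<ge> 1" and u: "\<And>j. j \<in> {1..n} \<Longrightarrow> norm (u j) < 1" and inj: "inj_on u {1..n}"
  shows "0 < uniform_separation_constant n u" "uniform_separation_constant n u \<le> 1"
proof -
  define d where "d = (\<lambda>i. \<Prod>k\<in>{1..n} - {i}. norm ((u i - u k) / (1 - cnj (u i) * u k)))"
  have "uniform_separation_constant n u = Min (d ` {1..n})"
    unfolding uniform_separation_constant_def d_def using \<open>n \<ge> 1\<close> by (intro cInf_eq_Min) auto
  moreover have "Min (d ` {1..n}) \<in> d ` {1..n}"
    using \<open>n \<ge> 1\<close> by (intro Min_in) auto
  ultimately obtain i where i: "i \<in> {1..n}" "uniform_separation_constant n u = d i"
    by auto
  have nz: "1 - cnj (u i) * u k \<noteq> 0" if "k \<in> {1..n}" for k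
    using one_minus_mult_neq_0[of "cnj (u i)" "u k"] u[OF i(1)] u[OF that] by simp
  have "norm (u i - u k) \<le> norm (1 - cnj (u i) * u k)" if "k \<in> {1..n}" for k
    using norm_diff_le_mobius[of "u i" "u k"] u[OF i(1)] u[OF that] by (simp add: norm_minus_commute)
  then have "d i \<le> 1"
    unfolding d_def using nz by (intro prod_le_1) (auto simp: norm_divide divide_le_eq)
  moreover have "d i > 0"
    unfolding d_def using nz inj i by (intro prod_pos) (auto dest: inj_onD)
  ultimately show "0 < uniform_separation_constant n u" "uniform_separation_constant n u \<le> 1"
    using i by auto
qed

text \<open>The terms are 1 - rho_k^2. The one with k = i contributes at most 1; the others satisfy
  1 - rho_k^2 <= - ln(rho_k^2), and the logarithms add up to that of the separation product.\<close>

lemma sum_reproducing_kernels_le: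
  assumes "n \<ge> 1" and u: "\<And>j. j \<in> {1..n} \<Longrightarrow> norm (u j) < 1" and inj: "inj_on u {1..n}"
    and i: "i \<in> {1..n}"
  shows "(\<Sum>k\<in>{1..n}. (1 - (norm (u i))\<^sup>2) * (1 - (norm (u k))\<^sup>2) / (norm (1 - cnj (u i) * u k))\<^sup>2)
    \<le> 1 + 2 * ln (1 / uniform_separation_constant n u)"
proof -
  define \<rho> where "\<rho> = (\<lambda>k. norm ((u i - u k) / (1 - cnj (u i) * u k)))"
  have nz: "1 - cnj (u i) * u k \<noteq> 0" if "k \<in> {1..n}" for k
    using one_minus_mult_neq_0[of "cnj (u i)" "u k"] u[OF i] u[OF that] by simp
  have pos: "\<rho> k > 0" if "k \<in> {1..n} - {i}" for k
    unfolding \<rho>_def using nz inj i that by (auto dest: inj_onD)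
  have "(\<Sum>k\<in>{1..n}. (1 - (norm (u i))\<^sup>2) * (1 - (norm (u k))\<^sup>2) / (norm (1 - cnj (u i) * u k))\<^sup>2)
      = (\<Sum>k\<in>{1..n}. 1 - (\<rho> k)\<^sup>2)"
    unfolding \<rho>_def by (intro sum.cong refl norm_mobius_quotient[symmetric] u i)
  also have "\<dots> = 1 - (\<rho> i)\<^sup>2 + (\<Sum>k\<in>{1..n} - {i}. 1 - (\<rho> k)\<^sup>2)"
    using i by (intro sum.remove) auto
  also have "\<dots> \<le> 1 + (\<Sum>k\<in>{1..n} - {i}. - 2 * ln (\<rho> k))"
  proof (intro add_mono sum_mono)
    fix k assume k: "k \<in> {1..n} - {i}"
    have "ln ((\<rho> k)\<^sup>2) \<le> (\<rho> k)\<^sup>2 - 1"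
      using pos[OF k] by (intro ln_le_minus_one) simp
    then show "1 - (\<rho> k)\<^sup>2 \<le> - 2 * ln (\<rho> k)"
      using pos[OF k] by (simp add: ln_realpow)
  qed simp
  also have "\<dots> = 1 - 2 * ln (\<Prod>k\<in>{1..n} - {i}. \<rho> k)"
    using pos by (subst ln_prod) (force simp: sum_distrib_left sum_negf)+
  also have "\<dots> \<le> 1 - 2 * ln (uniform_separation_constant n u)"
    using uniform_separation_constant_le[OF i, of u] uniform_separation_constant_bounds(1)[OF assms(1-3)]
    by (simp add: \<rho>_def)
  also have "\<dots> = 1 + 2 * ln (1 / uniform_separation_constant n u)"
    using uniform_separation_constant_bounds(1)[OF assms(1-3)] by (simp add: ln_div)
  finally show ?thesis .
qed

section \<open>Outer functions\<close>

text \<open>\<open>H\<close> is the integral of f against the Schwarz kernel (w + z) / (w - z),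
  whose real part is the Poisson kernel; holomorphy follows by differentiation under the
  integral.\<close>

lemma schwarz_integral:
  fixes f :: "complex \<Rightarrow> real"
  assumes f: "continuous_on (sphere 0 1) f"
  obtains H where "H holomorphic_on ball 0 1"
    and "\<And>z. norm z < 1 \<Longrightarrow> Re (H z) = circle_mean (\<lambda>w. poisson z w * f w)"
proof
  define H where "H = (\<lambda>z. circle_mean (\<lambda>w. (w + z) / (w - z) * of_real (f w)))"
  have nz: "w - z \<noteq> 0" if "norm w = 1" "norm z < 1" for w z :: complex
    using that by auto
  have ck: "continuous_on (sphere 0 1) (\<lambda>w. (w + z) / (w - z) * of_real (f w))" if "norm z < 1" for z
    by (intro continuous_intros f) (use nz that in auto)
  have "(\<lambda>z. integral (cbox 0 (2 * pi)) (\<lambda>t. (cis t + z) / (cis t - z) * of_real (f (cis t)))) holomorphic_on ball 0 1"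
  proof (rule leibniz_rule_holomorphic)
    fix z t assume "z \<in> ball (0::complex) 1"
    then have "cis t - z \<noteq> 0" by (intro nz) auto
    then show "((\<lambda>z. (cis t + z) / (cis t - z) * of_real (f (cis t))) has_field_derivative
        2 * cis t / (cis t - z)\<^sup>2 * of_real (f (cis t))) (at z within ball 0 1)"
      by (auto intro!: derivative_eq_intros simp: power2_eq_square algebra_simps)
  next
    fix z assume "z \<in> ball (0::complex) 1"
    then show "(\<lambda>t. (cis t + z) / (cis t - z) * of_real (f (cis t))) integrable_on cbox 0 (2 * pi)"
      using integrable_circle[OF ck] by simp
  next
    have "continuous_on (ball (0::complex) 1 \<times> cbox 0 (2 * pi)) (\<lambda>x. f (cis (snd x)))"
      by (rule continuous_on_compose2[OF f]) (auto intro!: continuous_intros)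
    then show "continuous_on (ball 0 1 \<times> cbox 0 (2 * pi))
        (\<lambda>(z, t). 2 * cis t / (cis t - z)\<^sup>2 * of_real (f (cis t)))"
      unfolding split_def by (intro continuous_intros) (use nz in auto)
  qed simp
  then show "H holomorphic_on ball 0 1"
    unfolding H_def circle_mean_def scaleR_conv_of_real by (intro holomorphic_intros) simp
  fix z :: complex assume z: "norm z < 1"
  show "Re (H z) = circle_mean (\<lambda>w. poisson z w * f w)"
    unfolding H_def Re_circle_mean[OF ck[OF z]]
  proof (rule circle_mean_cong)
    fix w :: complex assume w: "norm w = 1"
    have ww: "w * cnj w = 1" using complex_norm_square[of w] w by simp
    have "w \<noteq> 0" using w by auto
    have "w + z = w * (1 + z * cnj w)" "w - z = w * (1 - z * cnj w)"
      using ww by (simp_all add: algebra_simps)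
    then have "(w + z) / (w - z) = (1 + z * cnj w) / (1 - z * cnj w)"
      and "norm (w - z) = norm (1 - z * cnj w)"
      using \<open>w \<noteq> 0\<close> w by (simp_all add: norm_mult)
    moreover have "1 - z * cnj w \<noteq> 0"
      using one_minus_mult_neq_0[of z "cnj w"] z w by simp
    ultimately have "Re ((w + z) / (w - z)) = poisson z w"
      using Re_cayley[of "z * cnj w"] w by (simp add: poisson_def norm_mult)
    then show "Re ((w + z) / (w - z) * complex_of_real (f w)) = poisson z w * f w"
      by (simp only: times_complex.sel Re_complex_of_real Im_complex_of_real mult_zero_right diff_zero)
  qed
qed

text \<open>Jensen's inequality for the probability density \<open>poisson z\<close>: the tangent to
  exp at the mean L lies below exp and is averaged.\<close>

lemma exp_poisson_mean_le:
  fixes f :: "complex \<Rightarrow> real"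
  assumes f: "continuous_on (sphere 0 1) f" and z: "norm z < 1"
  shows "exp (circle_mean (\<lambda>w. poisson z w * f w)) \<le> circle_mean (\<lambda>w. poisson z w * exp (f w))"
proof -
  define L where "L = circle_mean (\<lambda>w. poisson z w * f w)"
  note cont = continuous_on_poisson[OF z] f
  have "continuous_on (sphere 0 1) (\<lambda>w. exp L * (1 - L) * poisson z w)"
    "continuous_on (sphere 0 1) (\<lambda>w. exp L * (poisson z w * f w))"
    by (intro continuous_intros cont)+
  then have "circle_mean (\<lambda>w. exp L * (1 - L) * poisson z w + exp L * (poisson z w * f w))
      = exp L * (1 - L) + exp L * L"
    by (simp only: circle_mean_add circle_mean_mult_left circle_mean_poisson[OF z] L_def[symmetric] mult_1_right)
  then have "exp L = circle_mean (\<lambda>w. exp L * (1 - L) * poisson z w + exp L * (poisson z w * f w))"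
    by (simp add: algebra_simps)
  also have "\<dots> \<le> circle_mean (\<lambda>w. poisson z w * exp (f w))"
  proof (rule circle_mean_mono)
    fix w
    have "1 + (f w - L) \<le> exp (f w - L)" by (rule exp_ge_add_one_self)
    then have "exp L * (1 + (f w - L)) \<le> exp L * exp (f w - L)" by simp
    also have "\<dots> = exp (f w)" by (simp add: exp_add[symmetric])
    finally have "poisson z w * (exp L * (1 + (f w - L))) \<le> poisson z w * exp (f w)"
      using poisson_nonneg[OF z] by (rule mult_left_mono)
    then show "exp L * (1 - L) * poisson z w + exp L * (poisson z w * f w) \<le> poisson z w * exp (f w)"
      by (simp add: algebra_simps)
  qed (intro continuous_intros cont)+
  finally show ?thesis unfolding L_def .
qed

text \<open>On the circle ln P_v is the real part of ln(1 - |v|^2) - 2 Ln(1 - cnj v w), holomorphic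
  on the closed disk since Re(1 - cnj v w) > 0 there. At w = v the second term is twice the first
  with the opposite sign.\<close>

lemma circle_mean_poisson_ln_poisson:
  assumes v: "norm v < 1"
  shows "circle_mean (\<lambda>w. poisson v w * ln (poisson v w)) = - ln (1 - (norm v)\<^sup>2)"
proof -
  have pos: "1 - (norm v)\<^sup>2 > 0" using v by (simp add: abs_square_less_1)
  have nz: "1 - cnj v * w \<noteq> 0" "1 - cnj v * w \<notin> \<real>\<^sub>\<le>\<^sub>0" if "norm w \<le> 1" for w
  proof -
    have "norm (cnj v * w) \<le> norm v" using that mult_left_mono[of "norm w" 1 "norm v"] by (simp add: norm_mult)
    with v have "Re (cnj v * w) < 1"
      using complex_Re_le_cmod[of "cnj v * w"] by linarith
    then have "Re (1 - cnj v * w) > 0" by simp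
    then show "1 - cnj v * w \<noteq> 0" "1 - cnj v * w \<notin> \<real>\<^sub>\<le>\<^sub>0"
      by (metis less_irrefl zero_complex.sel(1), metis complex_nonpos_Reals_iff not_less)
  qed
  define F where "F = (\<lambda>w. of_real (ln (1 - (norm v)\<^sup>2)) - 2 * Ln (1 - cnj v * w))"
  have "F holomorphic_on cball 0 1"
    unfolding F_def by (intro holomorphic_intros) (use nz in auto)
  have "Re (F w) = ln (poisson v w)" if "norm w = 1" for w
    using that nz[of w] pos v unfolding F_def poisson_def norm_diff_circle[OF that]
    by (simp add: ln_div ln_realpow)
  then have "circle_mean (\<lambda>w. poisson v w * ln (poisson v w)) = circle_mean (\<lambda>w. poisson v w * Re (F w))"
    by (intro circle_mean_cong) simp
  also have "\<dots> = Re (F v)"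
    by (rule poisson_integral_Re) fact+
  also have "1 - cnj v * v = of_real (1 - (norm v)\<^sup>2)"
    using complex_norm_square[of v] by (simp add: mult.commute)
  then have "Re (F v) = - ln (1 - (norm v)\<^sup>2)"
    unfolding F_def using pos by (simp add: Ln_of_real del: of_real_diff of_real_power)
  finally show ?thesis .
qed

(* exp H is the outer function of modulus P = sum_j b_j P_{v_j} on the circle.  The lower bound comes from
   P >= b_j P_{v_j}, because the Poisson integral of ln P_v at v is - ln (1 - |v|^2). *)
lemma outer_function:
  fixes v :: "'i \<Rightarrow> complex" and b :: "'i \<Rightarrow> real"
  assumes J: "finite J" and v: "\<And>j. j \<in> J \<Longrightarrow> norm (v j) < 1" and b: "\<And>j. j \<in> J \<Longrightarrow> b j \<ge> 0"
    and b_pos: "\<exists>j\<in>J. b j > 0"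
  obtains H where "H holomorphic_on ball 0 1"
    and "\<And>j. j \<in> J \<Longrightarrow> exp (Re (H (v j))) \<ge> b j / (1 - (norm (v j))\<^sup>2)"
    and "\<And>r. 0 \<le> r \<Longrightarrow> r < 1 \<Longrightarrow> circle_mean (\<lambda>w. exp (Re (H (of_real r * w)))) \<le> sum b J"
proof -
  define P where "P = (\<lambda>w. \<Sum>j\<in>J. b j * poisson (v j) w)"
  have contv: "continuous_on (sphere 0 1) (poisson (v j))" if "j \<in> J" for j
    by (rule continuous_on_poisson[OF v[OF that]])
  have contP: "continuous_on (sphere 0 1) P"
    unfolding P_def by (intro continuous_intros contv)
  have P_ge: "b j * poisson (v j) w \<le> P w" if "j \<in> J" for j w
    unfolding P_def using J that b v by (intro member_le_sum) (auto intro!: mult_nonneg_nonneg poisson_nonneg)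
  have P_pos: "P w > 0" if w: "norm w = 1" for w
  proof -
    obtain j where j: "j \<in> J" "b j > 0" using b_pos by blast
    then have "0 < b j * poisson (v j) w" using poisson_pos[OF v w] by simp
    with P_ge[OF j(1), of w] show ?thesis by simp
  qed
  have contln: "continuous_on (sphere 0 1) (\<lambda>w. ln (P w))"
    by (intro continuous_intros contP) (use P_pos in force)
  then obtain H where H: "H holomorphic_on ball 0 1"
    "\<And>z. norm z < 1 \<Longrightarrow> Re (H z) = circle_mean (\<lambda>w. poisson z w * ln (P w))"
    using schwarz_integral by blast
  show ?thesis
  proof (rule that[OF H(1)])
    fix j assume j: "j \<in> J"
    have pos: "1 - (norm (v j))\<^sup>2 > 0" using v[OF j] by (simp add: abs_square_less_1)
    show "b j / (1 - (norm (v j))\<^sup>2) \<le> exp (Re (H (v j)))"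
    proof (cases "b j = 0")
      case False
      with b[OF j] have "b j > 0" by simp
      have "ln (b j / (1 - (norm (v j))\<^sup>2)) = ln (b j) * circle_mean (poisson (v j))
          + circle_mean (\<lambda>w. poisson (v j) w * ln (poisson (v j) w))"
        using \<open>b j > 0\<close> pos by (simp add: ln_div circle_mean_poisson circle_mean_poisson_ln_poisson v[OF j])
      also have "\<dots> = circle_mean (\<lambda>w. ln (b j) * poisson (v j) w + poisson (v j) w * ln (poisson (v j) w))"
        by (subst circle_mean_add)
           (use poisson_pos[OF v[OF j]] in \<open>force intro!: continuous_intros contv j simp: circle_mean_mult_left\<close>)+
      also have "\<dots> \<le> circle_mean (\<lambda>w. poisson (v j) w * ln (P w))"
      proof (rule circle_mean_mono)
        fix w :: complex assume w: "norm w = 1"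
        have pp: "poisson (v j) w > 0" by (rule poisson_pos[OF v[OF j] w])
        have "ln (b j) + ln (poisson (v j) w) = ln (b j * poisson (v j) w)"
          using pp \<open>b j > 0\<close> by (simp add: ln_mult)
        also have "\<dots> \<le> ln (P w)"
          using P_ge[OF j, of w] pp \<open>b j > 0\<close> P_pos[OF w] by (subst ln_le_cancel_iff) auto
        finally have "poisson (v j) w * (ln (b j) + ln (poisson (v j) w)) \<le> poisson (v j) w * ln (P w)"
          using pp by simp
        then show "ln (b j) * poisson (v j) w + poisson (v j) w * ln (poisson (v j) w) \<le> poisson (v j) w * ln (P w)"
          by (simp add: algebra_simps)
      qed (use poisson_pos[OF v[OF j]] in \<open>force intro!: continuous_intros contv j contln\<close>)+
      also have "\<dots> = Re (H (v j))" using H(2) v[OF j] by simp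
      finally have "exp (ln (b j / (1 - (norm (v j))\<^sup>2))) \<le> exp (Re (H (v j)))" by simp
      then show ?thesis using \<open>b j > 0\<close> pos by simp
    qed simp
  next
    fix r :: real assume r: "0 \<le> r" "r < 1"
    have nz: "1 - cnj (v j) * (of_real r * w) \<noteq> 0" if "j \<in> J" "norm w \<le> 1" for j w
    proof (rule one_minus_mult_neq_0)
      show "norm (of_real r * w) \<le> 1"
        using r that mult_mono[of r 1 "norm w" 1] by (simp add: norm_mult)
    qed (use v that in auto)
    \<comment> \<open>The real part of \<open>E\<close> equals \<open>P\<close> on the circle.
      Jensen's inequality therefore gives exp(Re H) <= Re E inside the disk, and the mean of Re E
      over any smaller circle is its value at 0.\<close>
    define E where "E = (\<lambda>z. \<Sum>j\<in>J. of_real (b j) * ((1 + cnj (v j) * z) / (1 - cnj (v j) * z)))"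
    have Er: "(\<lambda>w. E (of_real r * w)) holomorphic_on cball 0 1"
      unfolding E_def by (intro holomorphic_intros) (use nz in auto)
    have E: "E holomorphic_on cball 0 1"
      unfolding E_def by (intro holomorphic_intros) (use one_minus_mult_neq_0[of "cnj (v _)"] v in auto)
    have rw: "norm (of_real r * w) < 1" if "norm w = 1" for w :: complex
      using that r by (simp add: norm_mult)
    have "circle_mean (\<lambda>w. exp (Re (H (of_real r * w)))) \<le> circle_mean (\<lambda>w. Re (E (of_real r * w)))"
    proof (rule circle_mean_mono)
      fix w :: complex assume w: "norm w = 1"
      let ?z = "of_real r * w"
      have "exp (Re (H ?z)) \<le> circle_mean (\<lambda>x. poisson ?z x * exp (ln (P x)))"
        unfolding H(2)[OF rw[OF w]] by (rule exp_poisson_mean_le[OF contln rw[OF w]])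
      also have "\<dots> = circle_mean (\<lambda>x. poisson ?z x * Re (E x))"
      proof (rule circle_mean_cong)
        fix x :: complex assume x: "norm x = 1"
        have "P x = Re (E x)"
          unfolding P_def E_def Re_sum by (intro sum.cong refl) (simp only: poisson_eq_Re[OF v x] times_complex.sel Re_complex_of_real Im_complex_of_real mult_zero_left diff_zero)
        then show "poisson ?z x * exp (ln (P x)) = poisson ?z x * Re (E x)"
          using P_pos[OF x] by simp
      qed
      also have "\<dots> = Re (E ?z)"
        by (rule poisson_integral_Re[OF E rw[OF w]])
      finally show "exp (Re (H ?z)) \<le> Re (E ?z)" .
    next
      have "continuous_on (sphere 0 1) (\<lambda>w. H (of_real r * w))"
        by (rule continuous_on_compose2[OF holomorphic_on_imp_continuous_on[OF H(1)]])
           (use rw in \<open>auto intro!: continuous_intros\<close>)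
      then show "continuous_on (sphere 0 1) (\<lambda>w. exp (Re (H (of_real r * w))))"
        by (intro continuous_intros)
      show "continuous_on (sphere 0 1) (\<lambda>w. Re (E (of_real r * w)))"
        by (intro continuous_intros continuous_on_subset[OF holomorphic_on_imp_continuous_on[OF Er]]) auto
    qed
    also have "\<dots> = Re (circle_mean (\<lambda>w. E (of_real r * w)))"
      by (subst Re_circle_mean) (auto intro: continuous_on_subset[OF holomorphic_on_imp_continuous_on[OF Er]])
    also have "\<dots> = Re (E 0)"
      by (simp add: circle_mean_holomorphic[OF Er])
    also have "\<dots> = sum b J" by (simp add: E_def)
    finally show "circle_mean (\<lambda>w. exp (Re (H (of_real r * w)))) \<le> sum b J" .
  qed
qed

section \<open>Interpolation and duality\<close>

lemma norm_le_hardy_inf_norm: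
  assumes "f \<in> hardy_inf_space" "norm z < 1"
  shows "norm (f z) \<le> hardy_inf_norm f"
  unfolding hardy_inf_norm_def
proof (rule cSUP_upper)
  show "bdd_above ((\<lambda>z. norm (f z)) ` unit_disk)"
    using assms(1) unfolding hardy_inf_space_def bounded_iff bdd_above_def by blast
qed (use assms in auto)

text \<open>A crude bound depending on the points. It guarantees that the infima in
  \<open>interpolation_constant\<close> are over nonempty sets and that the supremum is over a
  bounded one; real-valued \<open>INF\<close> and \<open>SUP\<close> carry no information
  otherwise.\<close>

lemma lagrange_interpolation_bound:
  fixes v :: "nat \<Rightarrow> complex"
  assumes v: "\<And>j. j \<in> {1..n} \<Longrightarrow> norm (v j) < 1" and inj: "inj_on v {1..n}"
  obtains C where "\<And>a. (\<And>j. j \<in> {1..n} \<Longrightarrow> norm (a j) \<le> 1) \<Longrightarrow>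
    \<exists>f\<in>hardy_inf_space. (\<forall>j\<in>{1..n}. f (v j) = a j) \<and> hardy_inf_norm f \<le> C"
proof
  define L where "L = (\<lambda>j z. \<Prod>k\<in>{1..n} - {j}. (z - v k) / (v j - v k))"
  define C where "C = (\<Sum>j\<in>{1..n}. \<Prod>k\<in>{1..n} - {j}. 2 / norm (v j - v k))"
  fix a :: "nat \<Rightarrow> complex" assume a: "\<And>j. j \<in> {1..n} \<Longrightarrow> norm (a j) \<le> 1"
  define f where "f = (\<lambda>z. if z \<in> unit_disk then \<Sum>j\<in>{1..n}. a j * L j z else 0)"
  have bound: "norm (f z) \<le> C" if z: "z \<in> unit_disk" for z
  proof -
    have "norm (f z) \<le> (\<Sum>j\<in>{1..n}. norm (a j * L j z))"
      unfolding f_def using z by (simp add: norm_sum)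
    also have "\<dots> \<le> C"
      unfolding C_def
    proof (rule sum_mono)
      fix j assume j: "j \<in> {1..n}"
      have "norm (L j z) \<le> (\<Prod>k\<in>{1..n} - {j}. 2 / norm (v j - v k))"
        unfolding L_def prod_norm[symmetric]
      proof (intro prod_mono conjI norm_ge_zero)
        fix k assume k: "k \<in> {1..n} - {j}"
        have "norm (z - v k) \<le> 2"
          using norm_triangle_ineq4[of z "v k"] z v[of k] k by simp
        then show "norm ((z - v k) / (v j - v k)) \<le> 2 / norm (v j - v k)"
          by (simp add: norm_divide divide_right_mono)
      qed
      then show "norm (a j * L j z) \<le> (\<Prod>k\<in>{1..n} - {j}. 2 / norm (v j - v k))"
        using a[OF j] mult_mono[of "norm (a j)" 1 "norm (L j z)"] by (simp add: norm_mult)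
    qed
    finally show ?thesis .
  qed
  have "(\<lambda>z. \<Sum>j\<in>{1..n}. a j * L j z) holomorphic_on unit_disk"
    unfolding L_def by (intro holomorphic_intros) (use inj in \<open>auto dest: inj_onD\<close>)
  then have "f holomorphic_on unit_disk"
    by (rule holomorphic_transform) (simp add: f_def)
  moreover have "bounded (f ` unit_disk)"
    unfolding bounded_iff using bound by blast
  ultimately have "f \<in> hardy_inf_space"
    unfolding hardy_inf_space_def disk_holomorphic_def by (simp add: f_def)
  moreover have "f (v i) = a i" if i: "i \<in> {1..n}" for i
  proof -
    have "L j (v i) = (if j = i then 1 else 0)" if "j \<in> {1..n}" for j
    proof (cases "j = i")
      case True
      have "v i \<noteq> v k" if "k \<in> {1..n} - {i}" for k
        using inj_onD[OF inj _ i, of k] that by auto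
      then show ?thesis unfolding L_def using True by (auto intro!: prod.neutral)
    next
      case False
      then show ?thesis unfolding L_def using i by (auto intro!: prod_zero)
    qed
    then show ?thesis
      unfolding f_def using i v[OF i] by (simp add: if_distrib[of "\<lambda>x. _ * x"] cong: if_cong)
  qed
  moreover have "hardy_inf_norm f \<le> C"
    unfolding hardy_inf_norm_def using bound by (intro cSUP_least) auto
  ultimately show "\<exists>f\<in>hardy_inf_space. (\<forall>j\<in>{1..n}. f (v j) = a j) \<and> hardy_inf_norm f \<le> C"
    by blast
qed

text \<open>Interpolating the constant data 1 already costs norm 1. The factor 2 leaves room below
  which some interpolant must exist, without asking whether the infimum is attained.\<close>

lemma interpolation_constant_bounds:
  fixes v :: "nat \<Rightarrow> complex"
  assumes "n \<ge> 1" and v: "\<And>j. j \<in> {1..n} \<Longrightarrow> norm (v j) < 1" and inj: "inj_on v {1..n}"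
  shows "interpolation_constant n v \<ge> 1"
    and "\<And>a. (\<And>j. j \<in> {1..n} \<Longrightarrow> norm (a j) \<le> 1) \<Longrightarrow>
      \<exists>f\<in>hardy_inf_space. (\<forall>j\<in>{1..n}. f (v j) = a j) \<and> hardy_inf_norm f \<le> 2 * interpolation_constant n v"
proof -
  define A where "A = {a :: nat \<Rightarrow> complex. \<forall>j\<in>{1..n}. norm (a j) \<le> 1}"
  define S where "S = (\<lambda>a. {f \<in> hardy_inf_space. \<forall>j\<in>{1..n}. f (v j) = a j})"
  define I where "I = (\<lambda>a. INF f\<in>S a. hardy_inf_norm f)"
  have \<kappa>: "interpolation_constant n v = (SUP a\<in>A. I a)"
    unfolding interpolation_constant_def A_def I_def S_def ..
  obtain C where C: "\<And>a. (\<And>j. j \<in> {1..n} \<Longrightarrow> norm (a j) \<le> 1) \<Longrightarrow>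
    \<exists>f\<in>hardy_inf_space. (\<forall>j\<in>{1..n}. f (v j) = a j) \<and> hardy_inf_norm f \<le> C"
    using lagrange_interpolation_bound[OF v inj] by blast
  have SC: "\<exists>f\<in>S a. hardy_inf_norm f \<le> C" if "a \<in> A" for a
    using C[of a] that unfolding S_def A_def by blast
  have below: "bdd_below (hardy_inf_norm ` S a)" for a
  proof (rule bdd_belowI2)
    fix f assume "f \<in> S a"
    then show "0 \<le> hardy_inf_norm f"
      using norm_le_hardy_inf_norm[of f 0] order_trans[OF norm_ge_zero] unfolding S_def by auto
  qed
  have "I a \<le> C" if "a \<in> A" for a
    using SC[OF that] below unfolding I_def by (meson cINF_lower order_trans)
  then have above: "bdd_above (I ` A)"
    by (rule bdd_aboveI2)
  have "1 \<le> I (\<lambda>_. 1)"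
    unfolding I_def
  proof (rule cINF_greatest)
    show "S (\<lambda>_. 1) \<noteq> {}" using SC[of "\<lambda>_. 1"] by (auto simp: A_def)
    fix f assume "f \<in> S (\<lambda>_. 1)"
    then have "f \<in> hardy_inf_space" "f (v 1) = 1"
      using \<open>n \<ge> 1\<close> by (auto simp: S_def)
    then show "1 \<le> hardy_inf_norm f"
      using norm_le_hardy_inf_norm[of f "v 1"] v[of 1] \<open>n \<ge> 1\<close> by simp
  qed
  also have "\<dots> \<le> interpolation_constant n v"
    unfolding \<kappa> by (rule cSUP_upper[OF _ above]) (simp add: A_def)
  finally show ge: "interpolation_constant n v \<ge> 1" .
  fix a :: "nat \<Rightarrow> complex" assume "\<And>j. j \<in> {1..n} \<Longrightarrow> norm (a j) \<le> 1"
  then have a: "a \<in> A" by (simp add: A_def)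
  have "I a \<le> interpolation_constant n v"
    unfolding \<kappa> by (rule cSUP_upper[OF a above])
  with ge have "(INF f\<in>S a. hardy_inf_norm f) < 2 * interpolation_constant n v"
    unfolding I_def by linarith
  then have "\<exists>f\<in>S a. hardy_inf_norm f < 2 * interpolation_constant n v"
    using SC[OF a] by (subst (asm) cINF_less_iff[OF _ below]) auto
  then show "\<exists>f\<in>hardy_inf_space. (\<forall>j\<in>{1..n}. f (v j) = a j) \<and> hardy_inf_norm f \<le> 2 * interpolation_constant n v"
    unfolding S_def by (auto intro: less_imp_le)
qed

section \<open>Linear algebra and duality in finite dimensions\<close>

lemma underdetermined_system_nonzero_solution:
  fixes A :: "'b \<Rightarrow> 'i \<Rightarrow> complex"
  assumes "finite B" "finite J" "card B < card J"
  shows "\<exists>w. (\<exists>j\<in>J. w j \<noteq> 0) \<and> (\<forall>b\<in>B. (\<Sum>j\<in>J. w j * A b j) = 0)"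
  using assms
proof (induction B arbitrary: J A rule: finite_induct)
  case empty
  then have "J \<noteq> {}" by auto
  then show ?case by (intro exI[of _ "\<lambda>_. 1"]) auto
next
  case (insert b B)
  show ?case
  proof (cases "\<forall>j\<in>J. A b j = 0")
    case True
    have "card B < card J" using insert by simp
    from insert.IH[OF \<open>finite J\<close> this, of A] True show ?thesis by auto
  next
    case False
    then obtain i where i: "i \<in> J" "A b i \<noteq> 0" by blast
    \<comment> \<open>Gaussian elimination: the unknown i is eliminated from the other equations by
      means of equation b, and \<open>w'\<close> below recovers it from that equation.\<close>
    define A' where "A' = (\<lambda>c j. A c j - A c i * A b j / A b i)"
    have "card B < card (J - {i})" using insert i by simp
    from insert.IH[OF _ this, of A'] insert.prems obtain w where
      w: "\<exists>j\<in>J - {i}. w j \<noteq> 0" "\<forall>c\<in>B. (\<Sum>j\<in>J - {i}. w j * A' c j) = 0" by auto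
    define w' where "w' = w(i := - (\<Sum>j\<in>J - {i}. w j * A b j) / A b i)"
    have sum: "(\<Sum>j\<in>J. w' j * A c j) = (\<Sum>j\<in>J - {i}. w j * A' c j)" for c
    proof -
      have "(\<Sum>j\<in>J. w' j * A c j) = w' i * A c i + (\<Sum>j\<in>J - {i}. w' j * A c j)"
        using insert.prems i by (intro sum.remove) auto
      also have "(\<Sum>j\<in>J - {i}. w' j * A c j) = (\<Sum>j\<in>J - {i}. w j * A c j)"
        by (intro sum.cong) (auto simp: w'_def)
      finally show ?thesis
        by (simp add: A'_def w'_def right_diff_distrib sum_subtractf sum_distrib_left sum_distrib_right sum_divide_distrib mult_ac)
    qed
    have "A' b j = 0" for j using i by (simp add: A'_def)
    then have "\<forall>c\<in>insert b B. (\<Sum>j\<in>J. w' j * A c j) = 0"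
      using w(2) by (simp add: sum)
    moreover have "\<exists>j\<in>J. w' j \<noteq> 0" using w(1) by (auto simp: w'_def)
    ultimately show ?thesis by blast
  qed
qed

(* A vector which comes within a factor 2 of the dual norm of l, so that no conjugate exponent is needed. *)
lemma lp_near_maximizer:
  fixes l :: "'i \<Rightarrow> real"
  assumes J: "finite J" and l: "\<And>j. j \<in> J \<Longrightarrow> l j \<ge> 0" and l_pos: "\<exists>j\<in>J. l j > 0" and "p > 0"
  obtains a where "\<And>j. j \<in> J \<Longrightarrow> a j \<ge> 0" "(\<Sum>j\<in>J. a j powr p) \<le> 1" "(\<Sum>j\<in>J. l j * a j) > 0"
    and "\<And>x s. (\<And>j. j \<in> J \<Longrightarrow> x j \<ge> 0) \<Longrightarrow> s > 0 \<Longrightarrow> (\<Sum>j\<in>J. x j powr p) \<le> s powr p \<Longrightarrow>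
      (\<Sum>j\<in>J. l j * x j) \<le> 2 * (\<Sum>j\<in>J. l j * a j) * s"
proof -
  define A where "A = {a :: 'i \<Rightarrow> real. (\<forall>j\<in>J. a j \<ge> 0) \<and> (\<Sum>j\<in>J. a j powr p) \<le> 1}"
  define N where "N = (SUP a\<in>A. \<Sum>j\<in>J. l j * a j)"
  \<comment> \<open>A single entry above 1 would exceed the budget for the p-th powers; hence the
    supremum \<open>N\<close> is finite.\<close>
  have le1: "a j \<le> 1" if a: "a \<in> A" and j: "j \<in> J" for a j
  proof (rule ccontr)
    assume "\<not> a j \<le> 1"
    then have "1 < a j powr p"
      using powr_less_mono2[of p 1 "a j"] \<open>p > 0\<close> by simp
    also have "\<dots> \<le> (\<Sum>j\<in>J. a j powr p)"
      using J j by (intro member_le_sum) auto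
    finally show False using a by (simp add: A_def)
  qed
  have bdd: "bdd_above ((\<lambda>a. \<Sum>j\<in>J. l j * a j) ` A)"
  proof (rule bdd_aboveI2)
    fix a assume "a \<in> A"
    then show "(\<Sum>j\<in>J. l j * a j) \<le> (\<Sum>j\<in>J. l j * 1)"
      using l le1 by (intro sum_mono mult_left_mono) auto
  qed
  have leN: "(\<Sum>j\<in>J. l j * a j) \<le> N" if "a \<in> A" for a
    unfolding N_def by (rule cSUP_upper[OF that bdd])
  obtain i where i: "i \<in> J" "l i > 0" using l_pos by blast
  \<comment> \<open>The unit vector at an index with l i > 0 shows N > 0, so that N / 2 lies
    strictly below the supremum.\<close>
  define e where "e = (\<lambda>j. if j = i then 1 else 0 :: real)"
  have "e j powr p = e j" for j by (simp add: e_def)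
  then have e: "e \<in> A" using J by (simp add: A_def) (simp add: e_def)
  have "0 < l i" by fact
  also have "l i = (\<Sum>j\<in>J. l j * e j)"
    using J i by (simp add: e_def if_distrib[of "\<lambda>x. _ * x"] cong: if_cong)
  also have "\<dots> \<le> N" by (rule leN[OF e])
  finally have "N > 0" .
  then have "N / 2 < N" by simp
  then obtain a where a: "a \<in> A" "N / 2 < (\<Sum>j\<in>J. l j * a j)"
    unfolding N_def using less_cSUP_iff[OF _ bdd] e by blast
  show ?thesis
  proof (rule that)
    show "\<And>j. j \<in> J \<Longrightarrow> a j \<ge> 0" "(\<Sum>j\<in>J. a j powr p) \<le> 1" using a by (auto simp: A_def)
    show "(\<Sum>j\<in>J. l j * a j) > 0" using a \<open>N > 0\<close> by linarith
    fix x :: "'i \<Rightarrow> real" and s :: real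
    assume x: "\<And>j. j \<in> J \<Longrightarrow> x j \<ge> 0" and s: "s > 0" and xs: "(\<Sum>j\<in>J. x j powr p) \<le> s powr p"
    have "(\<Sum>j\<in>J. (x j / s) powr p) = (\<Sum>j\<in>J. x j powr p) / s powr p"
      unfolding sum_divide_distrib by (intro sum.cong refl) (use x s in \<open>simp add: powr_divide\<close>)
    also have "\<dots> \<le> 1" using xs s by simp
    finally have "(\<lambda>j. x j / s) \<in> A" using x s by (simp add: A_def)
    from leN[OF this] have "(\<Sum>j\<in>J. l j * x j) / s \<le> N" by (simp add: sum_divide_distrib)
    then have "(\<Sum>j\<in>J. l j * x j) \<le> N * s" using s by (simp add: divide_le_eq)
    also have "\<dots> \<le> 2 * (\<Sum>j\<in>J. l j * a j) * s"
      using a s by (intro mult_right_mono) auto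
    finally show "(\<Sum>j\<in>J. l j * x j) \<le> 2 * (\<Sum>j\<in>J. l j * a j) * s" .
  qed
qed

section \<open>Test functions in the Hardy space\<close>

lemma integral_mean_eq_circle_mean:
  "integral_mean p f r = circle_mean (\<lambda>w. norm (f (of_real r * w)) powr p) powr (1 / p)"
  unfolding integral_mean_def circle_mean_def by simp

lemma continuous_on_dilation:
  assumes f: "f holomorphic_on ball 0 1" and r: "0 \<le> r" "r < 1"
  shows "continuous_on (sphere 0 1) (\<lambda>w. f (of_real r * w))"
  by (rule continuous_on_compose2[OF holomorphic_on_imp_continuous_on[OF f]])
     (use r in \<open>auto intro!: continuous_intros simp: norm_mult\<close>)

lemma continuous_on_dilation_powr:
  assumes f: "f holomorphic_on ball 0 1" and r: "0 \<le> r" "r < 1" and "p > 0"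
  shows "continuous_on (sphere 0 1) (\<lambda>w. norm (f (of_real r * w)) powr p)"
  using \<open>p > 0\<close> by (intro continuous_on_powr' continuous_intros continuous_on_dilation[OF f r]) auto

lemma circle_mean_le_of_hardy_norm_le:
  assumes f: "f holomorphic_on ball 0 1" and "p > 0" and "T \<ge> 0" and le: "hardy_norm p f \<le> ennreal T"
    and r: "0 \<le> r" "r < 1"
  shows "circle_mean (\<lambda>w. norm (f (of_real r * w)) powr p) \<le> T powr p"
proof -
  have nonneg: "circle_mean (\<lambda>w. norm (f (of_real r * w)) powr p) \<ge> 0"
    by (intro circle_mean_nonneg continuous_on_dilation_powr[OF f r \<open>p > 0\<close>]) auto
  have "ennreal (integral_mean p f r) \<le> ennreal T"
    using le r unfolding hardy_norm_def by (auto simp: SUP_le_iff)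
  then have "integral_mean p f r \<le> T" using \<open>T \<ge> 0\<close> by simp
  then have "integral_mean p f r powr p \<le> T powr p"
    using \<open>p > 0\<close> unfolding integral_mean_eq_circle_mean by (intro powr_mono2) auto
  then show ?thesis
    unfolding integral_mean_eq_circle_mean using nonneg \<open>p > 0\<close> by (simp add: powr_powr)
qed

lemma hardy_norm_le_one:
  assumes f: "f holomorphic_on ball 0 1" and "p > 0"
    and le: "\<And>r. 0 \<le> r \<Longrightarrow> r < 1 \<Longrightarrow> circle_mean (\<lambda>w. norm (f (of_real r * w)) powr p) \<le> 1"
  shows "hardy_norm p f \<le> 1"
  unfolding hardy_norm_def
proof (rule SUP_least)
  fix r :: real assume "r \<in> {0..<1}"
  then have r: "0 \<le> r" "r < 1" by auto
  have nonneg: "circle_mean (\<lambda>w. norm (f (of_real r * w)) powr p) \<ge> 0"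
    by (intro circle_mean_nonneg continuous_on_dilation_powr[OF f r \<open>p > 0\<close>]) auto
  have "integral_mean p f r \<le> 1 powr (1 / p)"
    unfolding integral_mean_eq_circle_mean using nonneg le[OF r] \<open>p > 0\<close> by (intro powr_mono2) auto
  then show "ennreal (integral_mean p f r) \<le> 1"
    by simp
qed

lemma hardy_extremal_function:
  fixes v :: "nat \<Rightarrow> complex" and a :: "nat \<Rightarrow> real" and w :: "nat \<Rightarrow> complex"
  assumes "p > 0" and "n \<ge> 1" and v: "\<And>j. j \<in> {1..n} \<Longrightarrow> norm (v j) < 1" and inj: "inj_on v {1..n}"
    and a: "\<And>j. j \<in> {1..n} \<Longrightarrow> a j \<ge> 0" and sum_a: "(\<Sum>j\<in>{1..n}. a j powr p) \<le> 1"
    and a_pos: "\<exists>j\<in>{1..n}. a j > 0"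
  obtains f where "f \<in> hardy_space p" "hardy_norm p f \<le> 1"
    "norm (\<Sum>j\<in>{1..n}. w j * f (v j)) \<ge> 1 / (2 * interpolation_constant n v) *
      (\<Sum>j\<in>{1..n}. norm (w j) * a j * (1 / (1 - (norm (v j))\<^sup>2)) powr (1 / p))"
proof -
  define \<kappa> where "\<kappa> = interpolation_constant n v"
  note \<kappa>_props = interpolation_constant_bounds[OF \<open>n \<ge> 1\<close> v inj, folded \<kappa>_def]
  have "\<kappa> > 0" using \<kappa>_props(1) by simp
  have b_pos: "\<exists>j\<in>{1..n}. a j powr p > 0" using a_pos by force
  obtain H where H: "H holomorphic_on ball 0 1"
    "\<And>j. j \<in> {1..n} \<Longrightarrow> exp (Re (H (v j))) \<ge> a j powr p / (1 - (norm (v j))\<^sup>2)"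
    "\<And>r. 0 \<le> r \<Longrightarrow> r < 1 \<Longrightarrow> circle_mean (\<lambda>w. exp (Re (H (of_real r * w)))) \<le> (\<Sum>j\<in>{1..n}. a j powr p)"
    using outer_function[of "{1..n}" v "\<lambda>j. a j powr p"] v b_pos by auto
  define e where "e = (\<lambda>z. exp (H z / of_real p))"
  have norm_e: "norm (e z) = exp (Re (H z)) powr (1 / p)" for z
    by (simp add: e_def powr_def)
  \<comment> \<open>Conjugate phases, so that all terms w_j f(v_j) become nonnegative. Where w_j = 0
    the convention sgn 0 = 0 gives the datum 0, which is admissible as well.\<close>
  define \<alpha> where "\<alpha> = (\<lambda>j. cnj (sgn (w j * e (v j))))"
  have "norm (\<alpha> j) \<le> 1" for j by (simp add: \<alpha>_def norm_sgn)
  then obtain F where F: "F \<in> hardy_inf_space" "\<And>j. j \<in> {1..n} \<Longrightarrow> F (v j) = \<alpha> j" "hardy_inf_norm F \<le> 2 * \<kappa>"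
    using \<kappa>_props(2)[of \<alpha>] by blast
  define f where "f = (\<lambda>z. if z \<in> unit_disk then F z / (2 * \<kappa>) * e z else 0)"
  have "F holomorphic_on unit_disk"
    using F(1) by (simp add: hardy_inf_space_def disk_holomorphic_def)
  then have "(\<lambda>z. F z / (2 * \<kappa>) * e z) holomorphic_on unit_disk"
    unfolding e_def using \<open>p > 0\<close> \<open>\<kappa> > 0\<close> by (intro holomorphic_intros H) auto
  then have hol: "f holomorphic_on unit_disk"
    by (rule holomorphic_transform) (simp add: f_def)
  \<comment> \<open>The division by 2 \<kappa> makes the rotating factor at most 1 in modulus, so
    the means of |f|^p are dominated by those of the outer function.\<close>
  have f_le: "norm (f z) powr p \<le> exp (Re (H z))" if z: "norm z < 1" for z
  proof -
    have "norm (F z) \<le> 2 * \<kappa>" using norm_le_hardy_inf_norm[OF F(1) z] F(3) by linarith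
    then have "norm (F z / (2 * \<kappa>)) \<le> 1"
      using \<open>\<kappa> > 0\<close> by (simp add: norm_divide norm_mult divide_le_eq)
    then have "norm (F z / (2 * \<kappa>)) * norm (e z) \<le> 1 * norm (e z)"
      by (intro mult_right_mono) auto
    then have "norm (f z) \<le> norm (e z)"
      unfolding norm_mult[symmetric] using z by (simp add: f_def)
    then have "norm (f z) powr p \<le> norm (e z) powr p"
      using \<open>p > 0\<close> by (intro powr_mono2) auto
    then show ?thesis using \<open>p > 0\<close> by (simp add: norm_e powr_powr)
  qed
  have hn: "hardy_norm p f \<le> 1"
  proof (rule hardy_norm_le_one[OF hol \<open>p > 0\<close>])
    fix r :: real assume r: "0 \<le> r" "r < 1"
    have "circle_mean (\<lambda>w. norm (f (of_real r * w)) powr p) \<le> circle_mean (\<lambda>w. exp (Re (H (of_real r * w))))"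
      by (intro circle_mean_mono continuous_on_dilation_powr[OF hol r \<open>p > 0\<close>] continuous_intros
          continuous_on_dilation[OF H(1) r] f_le) (use r in \<open>simp add: norm_mult\<close>)
    also have "\<dots> \<le> 1" using H(3)[OF r] sum_a by linarith
    finally show "circle_mean (\<lambda>w. norm (f (of_real r * w)) powr p) \<le> 1" .
  qed
  have "f \<in> hardy_space p"
    unfolding hardy_space_def disk_holomorphic_def using hol hn
    by (auto simp: f_def intro: le_less_trans)
  moreover have "norm (\<Sum>j\<in>{1..n}. w j * f (v j)) \<ge> 1 / (2 * \<kappa>) *
      (\<Sum>j\<in>{1..n}. norm (w j) * a j * (1 / (1 - (norm (v j))\<^sup>2)) powr (1 / p))"
  proof -
    have sgn: "x * cnj (sgn x) = of_real (norm x)" for x :: complex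
      using complex_norm_square[of x] by (cases "x = 0") (simp_all add: sgn_eq power2_eq_square field_simps)
    have "w j * f (v j) = of_real (norm (w j * e (v j)) / (2 * \<kappa>))" if "j \<in> {1..n}" for j
    proof -
      have "w j * f (v j) = (w j * e (v j)) * \<alpha> j / (2 * \<kappa>)"
        using v[OF that] F(2)[OF that] by (simp add: f_def)
      then show ?thesis
        unfolding \<alpha>_def sgn by simp
    qed
    then have "(\<Sum>j\<in>{1..n}. w j * f (v j)) = of_real (\<Sum>j\<in>{1..n}. norm (w j * e (v j)) / (2 * \<kappa>))"
      by simp
    then have "norm (\<Sum>j\<in>{1..n}. w j * f (v j)) = \<bar>\<Sum>j\<in>{1..n}. norm (w j * e (v j)) / (2 * \<kappa>)\<bar>"
      by (simp only: norm_of_real)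
    moreover have "1 / (2 * \<kappa>) * (\<Sum>j\<in>{1..n}. norm (w j) * a j * (1 / (1 - (norm (v j))\<^sup>2)) powr (1 / p))
        \<le> (\<Sum>j\<in>{1..n}. norm (w j * e (v j)) / (2 * \<kappa>))"
      unfolding sum_distrib_left
    proof (rule sum_mono)
      fix j assume j: "j \<in> {1..n}"
      have pos: "1 - (norm (v j))\<^sup>2 > 0" using v[OF j] by (simp add: abs_square_less_1)
      have "a j * (1 / (1 - (norm (v j))\<^sup>2)) powr (1 / p) = (a j powr p / (1 - (norm (v j))\<^sup>2)) powr (1 / p)"
        using a[OF j] pos \<open>p > 0\<close> by (simp add: powr_divide powr_powr)
      also have "\<dots> \<le> norm (e (v j))"
        unfolding norm_e using H(2)[OF j] pos \<open>p > 0\<close> by (intro powr_mono2) auto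
      finally have "norm (w j) * (a j * (1 / (1 - (norm (v j))\<^sup>2)) powr (1 / p)) \<le> norm (w j) * norm (e (v j))"
        by (rule mult_left_mono) simp
      then have "(norm (w j) * (a j * (1 / (1 - (norm (v j))\<^sup>2)) powr (1 / p))) / (2 * \<kappa>)
          \<le> norm (w j) * norm (e (v j)) / (2 * \<kappa>)"
        using \<open>\<kappa> > 0\<close> by (intro divide_right_mono) auto
      then show "1 / (2 * \<kappa>) * (norm (w j) * a j * (1 / (1 - (norm (v j))\<^sup>2)) powr (1 / p))
          \<le> norm (w j * e (v j)) / (2 * \<kappa>)"
        by (simp add: norm_mult mult.assoc)
    qed
    ultimately show ?thesis by linarith
  qed
  ultimately show ?thesis using that hn unfolding \<kappa>_def by blast
qed

text \<open>There are fewer basis functions than points, so some nonzero combination of point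
  evaluations vanishes on the basis; its kernel is a subspace and thus contains the whole
  range.\<close>

lemma rank_less_annihilator:
  fixes R :: "('a \<Rightarrow> complex) \<Rightarrow> 'b \<Rightarrow> complex" and u :: "'i \<Rightarrow> 'b"
  assumes "rank_less X R (card J)" and J: "finite J"
  obtains w where "\<exists>j\<in>J. w j \<noteq> 0" and "\<And>f. f \<in> X \<Longrightarrow> (\<Sum>j\<in>J. w j * R f (u j)) = 0"
proof -
  obtain B where B: "finite B" "cfun.span B = R ` X" "card B < card J"
    using assms(1) unfolding rank_less_def by blast
  from underdetermined_system_nonzero_solution[OF B(1) J B(3), of "\<lambda>b j. b (u j)"]
  obtain w where w: "\<exists>j\<in>J. w j \<noteq> 0" "\<forall>b\<in>B. (\<Sum>j\<in>J. w j * b (u j)) = 0" by blast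
  have "cfun.subspace {h. (\<Sum>j\<in>J. w j * h (u j)) = 0}"
    unfolding cfun.subspace_def
    by (auto simp: distrib_left sum.distrib mult.left_commute sum_distrib_left[symmetric])
  then have "cfun.span B \<subseteq> {h. (\<Sum>j\<in>J. w j * h (u j)) = 0}"
    using w(2) by (intro cfun.span_minimal) auto
  then show ?thesis using w(1) B(2) that by blast
qed

section \<open>Assembly of the lower bound\<close>

theorem theorem2p4:
  fixes p :: real
  assumes "1 \<le> p"
  shows "\<exists>c::real. c > 0 \<and>
    (\<forall>(\<phi> :: complex \<Rightarrow> complex) (n :: nat) (u :: nat \<Rightarrow> complex) (v :: nat \<Rightarrow> complex).
       \<phi> holomorphic_on unit_disk \<longrightarrow> \<phi> ` unit_disk \<subseteq> unit_disk \<longrightarrow>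
       n \<ge> 1 \<longrightarrow>
       (\<forall>j\<in>{1..n}. u j \<in> unit_disk) \<longrightarrow>
       (\<forall>j\<in>{1..n}. v j = \<phi> (u j)) \<longrightarrow>
       inj_on v {1..n} \<longrightarrow>
       hardy_approximation_number p n (composition_operator \<phi>) \<ge>
         ennreal (c * inverse (interpolation_constant n v)
           * (1 + ln (1 / uniform_separation_constant n u)) powr (- 1 / min p 2)
           * (INF j\<in>{1..n}. ((1 - (norm (u j))\<^sup>2) / (1 - (norm (v j))\<^sup>2)) powr (1 / p))))"
proof (intro exI[of _ "1 / 128"] conjI allI impI)
  fix \<phi> :: "complex \<Rightarrow> complex" and n :: nat and u v :: "nat \<Rightarrow> complex"
  assume \<phi>: "\<phi> holomorphic_on unit_disk" "\<phi> ` unit_disk \<subseteq> unit_disk" and n: "n \<ge> 1"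
    and u_disk: "\<forall>j\<in>{1..n}. u j \<in> unit_disk" and v_eq: "\<forall>j\<in>{1..n}. v j = \<phi> (u j)" and inj_v: "inj_on v {1..n}"
  have "p > 0" using assms by simp
  have u: "norm (u j) < 1" if "j \<in> {1..n}" for j using u_disk that by simp
  have v: "norm (v j) < 1" if "j \<in> {1..n}" for j
  proof -
    have "\<phi> (u j) \<in> unit_disk" using \<phi>(2) u_disk that by blast
    then show ?thesis using v_eq that by simp
  qed
  have inj_u: "inj_on u {1..n}" using inj_v v_eq by (metis (no_types, lifting) inj_on_def)
  define \<kappa> where "\<kappa> = interpolation_constant n v"
  define L where "L = 1 + ln (1 / uniform_separation_constant n u)"
  define I where "I = (INF j\<in>{1..n}. ((1 - (norm (u j))\<^sup>2) / (1 - (norm (v j))\<^sup>2)) powr (1 / p))"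
  \<comment> \<open>The constant 128 collects 2 from the near-optimal interpolant, 2 from the
    near-maximizer, 16 from 8 M <= 16 L, and a last 2 that turns the final estimate into a
    contradiction.\<close>
  define T where "T = 1 / 128 * inverse \<kappa> * L powr (- 1 / min p 2) * I"
  define M where "M = 1 + 2 * ln (1 / uniform_separation_constant n u)"
  define m where "m = (\<lambda>j. 1 - (norm (u j))\<^sup>2)"
  have "\<kappa> > 0"
    using interpolation_constant_bounds(1)[OF n v inj_v] unfolding \<kappa>_def by linarith
  have "ln (1 / uniform_separation_constant n u) \<ge> 0"
    using uniform_separation_constant_bounds[OF n u inj_u] by (intro ln_ge_zero) auto
  then have "L \<ge> 1" "M \<ge> 1" "M \<le> 2 * L" by (auto simp: L_def M_def)
  have m_pos: "m j > 0" if "j \<in> {1..n}" for j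
    unfolding m_def using u[OF that] by (simp add: abs_square_less_1)
  have mv_pos: "1 - (norm (v j))\<^sup>2 > 0" if "j \<in> {1..n}" for j
    using v[OF that] by (simp add: abs_square_less_1)
  have I_le: "I \<le> (m j / (1 - (norm (v j))\<^sup>2)) powr (1 / p)" if "j \<in> {1..n}" for j
    unfolding I_def m_def by (rule cINF_lower) (use that in auto)
  have "I > 0"
  proof -
    have "I = Min ((\<lambda>j. (m j / (1 - (norm (v j))\<^sup>2)) powr (1 / p)) ` {1..n})"
      unfolding I_def m_def using n by (intro cInf_eq_Min) auto
    also have "\<dots> \<in> (\<lambda>j. (m j / (1 - (norm (v j))\<^sup>2)) powr (1 / p)) ` {1..n}"
      using n by (intro Min_in) auto
    finally show ?thesis using m_pos mv_pos by force
  qed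
  have "T > 0" unfolding T_def using \<open>\<kappa> > 0\<close> \<open>L \<ge> 1\<close> \<open>I > 0\<close> by auto
  have "ennreal T \<le> hardy_approximation_number p n (composition_operator \<phi>)"
    unfolding hardy_approximation_number_def approximation_number_def
  proof (rule INF_greatest, rule ccontr, goal_cases)
    case (1 R)
    then have lin: "linear_between (hardy_space p) (hardy_space p) R" and rank: "rank_less (hardy_space p) R n"
      and less: "operator_norm (hardy_space p) (hardy_norm p) (hardy_norm p) (\<lambda>f. composition_operator \<phi> f - R f) < ennreal T"
      by auto
    obtain w where w: "\<exists>j\<in>{1..n}. w j \<noteq> 0"
      "\<And>f. f \<in> hardy_space p \<Longrightarrow> (\<Sum>j\<in>{1..n}. w j * R f (u j)) = 0"
      using rank_less_annihilator[of "hardy_space p" R "{1..n}" u] rank by auto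
    \<comment> \<open>With x_j = m_j^(1/p) |g(u_j)|, the quantity controlled in l^p by the
      embedding, the pairing of l with x is the sum of |w_j g(u_j)|.\<close>
    define l where "l = (\<lambda>j. norm (w j) / m j powr (1 / p))"
    have l: "l j \<ge> 0" for j by (simp add: l_def)
    obtain i where i: "i \<in> {1..n}" "w i \<noteq> 0" using w(1) by blast
    have "l i > 0" using i(2) m_pos[OF i(1)] by (simp add: l_def)
    with i(1) have "\<exists>j\<in>{1..n}. l j > 0" by blast
    then obtain a where a: "\<And>j. j \<in> {1..n} \<Longrightarrow> a j \<ge> 0" "(\<Sum>j\<in>{1..n}. a j powr p) \<le> 1"
      "(\<Sum>j\<in>{1..n}. l j * a j) > 0"
      and a_max: "\<And>x s. (\<And>j. j \<in> {1..n} \<Longrightarrow> x j \<ge> 0) \<Longrightarrow> s > 0 \<Longrightarrow> (\<Sum>j\<in>{1..n}. x j powr p) \<le> s powr p \<Longrightarrow>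
      (\<Sum>j\<in>{1..n}. l j * x j) \<le> 2 * (\<Sum>j\<in>{1..n}. l j * a j) * s"
      by (rule lp_near_maximizer[OF finite_atLeastAtMost l _ \<open>p > 0\<close>]) blast+
    define A where "A = (\<Sum>j\<in>{1..n}. l j * a j)"
    have "\<exists>j\<in>{1..n}. a j > 0"
    proof (rule ccontr)
      assume "\<not> ?thesis"
      then have "\<And>j. j \<in> {1..n} \<Longrightarrow> a j = 0" using a(1) by force
      then show False using a(3) by simp
    qed
    from hardy_extremal_function[OF \<open>p > 0\<close> n v inj_v a(1,2) this, of w]
    obtain f where f: "f \<in> hardy_space p" "hardy_norm p f \<le> 1"
      and f_sum: "norm (\<Sum>j\<in>{1..n}. w j * f (v j)) \<ge> 1 / (2 * \<kappa>) *
        (\<Sum>j\<in>{1..n}. norm (w j) * a j * (1 / (1 - (norm (v j))\<^sup>2)) powr (1 / p))"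
      unfolding \<kappa>_def by blast
    define g where "g = composition_operator \<phi> f - R f"
    have fh: "f holomorphic_on unit_disk" and Rfh: "R f holomorphic_on unit_disk"
      using f(1) lin by (auto simp: hardy_space_def disk_holomorphic_def linear_between_def)
    have "(\<lambda>z. f (\<phi> z)) holomorphic_on unit_disk"
      using holomorphic_on_compose_gen[OF \<phi>(1) fh \<phi>(2)] by (simp add: o_def)
    then have "(\<lambda>z. f (\<phi> z) - R f z) holomorphic_on unit_disk"
      by (intro holomorphic_intros Rfh)
    then have gh: "g holomorphic_on unit_disk"
      by (rule holomorphic_transform) (simp add: g_def composition_operator_def)
    have "hardy_norm p g \<le> operator_norm (hardy_space p) (hardy_norm p) (hardy_norm p) (\<lambda>f. composition_operator \<phi> f - R f)"
      unfolding operator_norm_def g_def using f by (intro SUP_upper) auto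
    with less have "hardy_norm p g \<le> ennreal T" by simp
    then have mean: "circle_mean (\<lambda>w. norm (g (of_real r * w)) powr p) \<le> T powr p" if "0 < r" "r < 1" for r
      using circle_mean_le_of_hardy_norm_le[OF gh \<open>p > 0\<close>, of T r] \<open>T > 0\<close> that by simp
    have carleson: "(\<Sum>j\<in>{1..n}. m j * norm (g (u j)) powr p) \<le> 8 * M * T powr p"
      unfolding m_def
      by (rule carleson_embedding[OF _ u _ _ \<open>p > 0\<close> gh mean])
         (use sum_reproducing_kernels_le[OF n u inj_u] \<open>M \<ge> 1\<close> in \<open>auto simp: M_def\<close>)
    \<comment> \<open>The l^p bound for that vector x, to be inserted into
      \<open>a_max\<close>.\<close>
    define s where "s = (8 * M) powr (1 / p) * T"
    have "s > 0" using \<open>M \<ge> 1\<close> \<open>T > 0\<close> by (simp add: s_def)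
    have "s powr p = 8 * M * T powr p"
      unfolding s_def using \<open>M \<ge> 1\<close> \<open>T > 0\<close> \<open>p > 0\<close> by (simp add: powr_mult powr_powr)
    moreover have "(m j powr (1 / p) * norm (g (u j))) powr p = m j * norm (g (u j)) powr p" if "j \<in> {1..n}" for j
      using m_pos[OF that] \<open>p > 0\<close> by (simp add: powr_mult powr_powr)
    ultimately have "(\<Sum>j\<in>{1..n}. (m j powr (1 / p) * norm (g (u j))) powr p) \<le> s powr p"
      using carleson by simp
    then have "(\<Sum>j\<in>{1..n}. l j * (m j powr (1 / p) * norm (g (u j)))) \<le> 2 * A * s"
      unfolding A_def by (intro a_max \<open>s > 0\<close>) auto
    also have "(\<Sum>j\<in>{1..n}. l j * (m j powr (1 / p) * norm (g (u j)))) = (\<Sum>j\<in>{1..n}. norm (w j * g (u j)))"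
    proof (rule sum.cong)
      fix j assume "j \<in> {1..n}"
      then show "l j * (m j powr (1 / p) * norm (g (u j))) = norm (w j * g (u j))"
        using m_pos[of j] by (simp add: l_def norm_mult)
    qed simp
    finally have "norm (\<Sum>j\<in>{1..n}. w j * g (u j)) \<le> 2 * A * s"
      by (rule order_trans[OF norm_sum])
    also have "(\<Sum>j\<in>{1..n}. w j * g (u j)) = (\<Sum>j\<in>{1..n}. w j * f (v j)) - (\<Sum>j\<in>{1..n}. w j * R f (u j))"
      unfolding sum_subtractf[symmetric]
    proof (rule sum.cong)
      fix j assume "j \<in> {1..n}"
      then show "w j * g (u j) = w j * f (v j) - w j * R f (u j)"
        using u[of j] v_eq by (simp add: g_def composition_operator_def right_diff_distrib)
    qed simp
    also have "\<dots> = (\<Sum>j\<in>{1..n}. w j * f (v j))" using w(2)[OF f(1)] by simp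
    finally have "1 / (2 * \<kappa>) * (\<Sum>j\<in>{1..n}. norm (w j) * a j * (1 / (1 - (norm (v j))\<^sup>2)) powr (1 / p)) \<le> 2 * A * s"
      using f_sum by linarith
    \<comment> \<open>The factor m_j^(-1/p) inside l_j and the growth (1 - |v_j|^2)^(-1/p) of the
      test function combine into the ratio whose infimum is \<open>I\<close>.\<close>
    moreover have "I * A \<le> (\<Sum>j\<in>{1..n}. norm (w j) * a j * (1 / (1 - (norm (v j))\<^sup>2)) powr (1 / p))"
      unfolding A_def sum_distrib_left
    proof (rule sum_mono)
      fix j assume j: "j \<in> {1..n}"
      have "I * (l j * a j) \<le> (m j / (1 - (norm (v j))\<^sup>2)) powr (1 / p) * (l j * a j)"
        using l a(1)[OF j] by (intro mult_right_mono I_le[OF j] mult_nonneg_nonneg)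
      also have "\<dots> = norm (w j) * a j * (1 / (1 - (norm (v j))\<^sup>2)) powr (1 / p)"
        using m_pos[OF j] mv_pos[OF j] by (simp add: l_def powr_divide)
      finally show "I * (l j * a j) \<le> norm (w j) * a j * (1 / (1 - (norm (v j))\<^sup>2)) powr (1 / p)" .
    qed
    then have "1 / (2 * \<kappa>) * (I * A) \<le>
        1 / (2 * \<kappa>) * (\<Sum>j\<in>{1..n}. norm (w j) * a j * (1 / (1 - (norm (v j))\<^sup>2)) powr (1 / p))"
      using \<open>\<kappa> > 0\<close> by (intro mult_left_mono) auto
    ultimately have "1 / (2 * \<kappa>) * (I * A) \<le> 2 * A * s" by linarith
    \<comment> \<open>Division by A > 0 removes the dependence on the functional w.\<close>
    then have "I \<le> 4 * \<kappa> * s"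
      using \<open>\<kappa> > 0\<close> a(3) unfolding A_def[symmetric] by (simp add: field_simps)
    \<comment> \<open>Besides M <= 2 L this uses 1/p <= 1 for the base 16, and L >= 1 to enlarge the
      exponent of L from 1/p to 1 / min p 2.\<close>
    also have "s \<le> 16 * L powr (1 / min p 2) * T"
      unfolding s_def
    proof (intro mult_right_mono)
      have "(8 * M) powr (1 / p) \<le> (16 * L) powr (1 / p)"
        using \<open>M \<ge> 1\<close> \<open>M \<le> 2 * L\<close> \<open>p > 0\<close> by (intro powr_mono2) auto
      also have "\<dots> = 16 powr (1 / p) * L powr (1 / p)" using \<open>L \<ge> 1\<close> by (simp add: powr_mult)
      also have "\<dots> \<le> 16 powr 1 * L powr (1 / min p 2)"
        using \<open>L \<ge> 1\<close> assms by (intro mult_mono powr_mono frac_le) auto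
      finally show "(8 * M) powr (1 / p) \<le> 16 * L powr (1 / min p 2)" by simp
    qed (use \<open>T > 0\<close> in simp)
    then have "4 * \<kappa> * s \<le> 4 * \<kappa> * (16 * L powr (1 / min p 2) * T)"
      using \<open>\<kappa> > 0\<close> by (intro mult_left_mono) auto
    \<comment> \<open>By the choice of \<open>T\<close> the chain now reads I <= I / 2, which is
      impossible for I > 0.\<close>
    also have "\<dots> = 1 / 2 * (L powr (1 / min p 2) * L powr (- 1 / min p 2)) * I"
      unfolding T_def using \<open>\<kappa> > 0\<close> by (simp add: field_simps)
    also have "L powr (1 / min p 2) * L powr (- 1 / min p 2) = 1"
      using \<open>L \<ge> 1\<close> by (simp add: powr_add[symmetric] minus_divide_left[symmetric])
    finally show False using \<open>I > 0\<close> by simp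
  qed
  then show "ennreal (1 / 128 * inverse (interpolation_constant n v)
           * (1 + ln (1 / uniform_separation_constant n u)) powr (- 1 / min p 2)
           * (INF j\<in>{1..n}. ((1 - (norm (u j))\<^sup>2) / (1 - (norm (v j))\<^sup>2)) powr (1 / p)))
        \<le> hardy_approximation_number p n (composition_operator \<phi>)"
    unfolding T_def \<kappa>_def L_def I_def .
qed simp

end
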